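(* Let $\Pi=(P,L)$ be a planar, connected and co-connected partial linear space containing two distinct non-collinear points. Suppose the following hold in $\Pi$: (a) every plane is either isomorphic to a dual affine plane or linear; (b) in a linear plane no $4$ lines intersect in $6$ points; (c) for all points $x$ and $y$, $x^\perp\subseteq y^\perp$ implies $x=y$; (d) for all $l\in L$ we have $|l|\geq 4$ and $l^{\perp\perp}=l$. Then $\Pi$ is isomorphic to the geometry of hyperbolic lines in a non-degenerate polar space of rank at least $2$.
   Context: A partial linear space $\Pi=(P,L)$ consists of a set $P$ of points and a set $L$ of subsets of $P$ of size at least $2$, called lines, such that two distinct points are in at most one line. Distinct points $p,q$ on a common line are called collinear, $p\sim q$. A point is not collinear to itself. $p\perp q$ means that $p$ and $q$ are equal or non-collinear; $p^\perp=\{q: q\perp p\}$; for $X\subseteq P$, $X^\perp=\bigcap_{x\in X}x^\perp$. $\Pi$ is connected if the graph $(P,\sim)$ is connected, and co-connected if the graph $(P,\perp)$ is connected. A subspace is a subset $X\subseteq P$ containing every line that meets it in at least two points; the subspace generated by a set is the intersection of all subspaces containing it. A plane is a subspace generated by two distinct intersecting lines. $\Pi$ is planar if every pair of (distinct) intersecting lines is contained in a unique plane. A (sub)space is linear if any two distinct points of it are collinear. A dual affine plane is the partial linear space obtained from a projective plane by removing one point together with all lines through it and keeping the remaining lines, with the points not on removed lines deleted appropriately dually; precisely, it is the dual of an affine plane: its points are the lines of an affine plane, and its lines are the pencils of affine lines through an affine point. "$4$ lines intersect in $6$ points" means that four distinct lines meet pairwise in six distinct points. A polar space is a partial linear space $(\mathcal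 P,\mathcal L)$ such that for each point $p$ and line $l$ with $p\notin l$, $p$ is collinear with exactly one or all points of $l$. It is non-degenerate if no point is equal or collinear to all points. A non-degenerate polar space has rank at least $2$ iff it contains lines. For a set $X$ of points of a polar space let $X^{\perp_{\mathcal S}}$ be the set of points equal or collinear (in the polar space) to every point of $X$. A hyperbolic line is a set $\{x,y\}^{\perp_{\mathcal S}\perp_{\mathcal S}}$ with $x,y$ non-collinear distinct points of the polar space; the geometry of hyperbolic lines is the partial linear space on the points of the polar space whose lines are the hyperbolic lines. *)

theory Defs
  imports Main
begin

locale partial_linear_space =
  fixes P :: "'a set" and L :: "'a set set"
  assumes line_subset: "l \<in> L \<Longrightarrow> l \<subseteq> P"
    and line_two_points: "l \<in> L \<Longrightarrow> \<exists>x\<in>l. \<exists>y\<in>l. x \<noteq> y"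
    and line_unique: "\<lbrakk>l \<in> L; m \<in> L; x \<noteq> y; x \<in> l; y \<in> l; x \<in> m; y \<in> m\<rbrakk> \<Longrightarrow> l = m"

definition pls_collinear :: "'a set set \<Rightarrow> 'a \<Rightarrow> 'a \<Rightarrow> bool" where
  "pls_collinear L p q \<longleftrightarrow> p \<noteq> q \<and> (\<exists>l\<in>L. p \<in> l \<and> q \<in> l)"

definition pls_perp :: "'a set set \<Rightarrow> 'a \<Rightarrow> 'a \<Rightarrow> bool" where
  "pls_perp L p q \<longleftrightarrow> p = q \<or> \<not> pls_collinear L p q"

definition perp_set :: "'a set \<Rightarrow> 'a set set \<Rightarrow> 'a set \<Rightarrow> 'a set" where
  "perp_set P L X = {q\<in>P. \<forall>x\<in>X. pls_perp L q x}"

definition graph_connected :: "'a set \<Rightarrow> ('a \<Rightarrow> 'a \<Rightarrow> bool) \<Rightarrow> bool" where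
  "graph_connected V R \<longleftrightarrow>
     (\<forall>x\<in>V. \<forall>y\<in>V. (x, y) \<in> {(u, v). u \<in> V \<and> v \<in> V \<and> R u v}\<^sup>*)"

definition pls_connected :: "'a set \<Rightarrow> 'a set set \<Rightarrow> bool" where
  "pls_connected P L \<longleftrightarrow> graph_connected P (pls_collinear L)"

definition pls_coconnected :: "'a set \<Rightarrow> 'a set set \<Rightarrow> bool" where
  "pls_coconnected P L \<longleftrightarrow> graph_connected P (pls_perp L)"

definition pls_subspace :: "'a set \<Rightarrow> 'a set set \<Rightarrow> 'a set \<Rightarrow> bool" where
  "pls_subspace P L X \<longleftrightarrow> X \<subseteq> P \<and>
     (\<forall>l\<in>L. (\<exists>x\<in>l \<inter> X. \<exists>y\<in>l \<inter> X. x \<noteq> y) \<longrightarrow> l \<subseteq> X)"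

definition pls_generated :: "'a set \<Rightarrow> 'a set set \<Rightarrow> 'a set \<Rightarrow> 'a set" where
  "pls_generated P L S = \<Inter>{X. pls_subspace P L X \<and> S \<subseteq> X}"

definition lines_in :: "'a set set \<Rightarrow> 'a set \<Rightarrow> 'a set set" where
  "lines_in L X = {l\<in>L. l \<subseteq> X}"

definition linear_on :: "'a set set \<Rightarrow> 'a set \<Rightarrow> bool" where
  "linear_on L X \<longleftrightarrow> (\<forall>x\<in>X. \<forall>y\<in>X. x \<noteq> y \<longrightarrow> pls_collinear L x y)"

definition pls_plane :: "'a set \<Rightarrow> 'a set set \<Rightarrow> 'a set \<Rightarrow> bool" where
  "pls_plane P L X \<longleftrightarrow>
     (\<exists>l\<in>L. \<exists>m\<in>L. l \<noteq> m \<and> l \<inter> m \<noteq> {} \<and> X = pls_generated P L (l \<union> m))"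

definition planar :: "'a set \<Rightarrow> 'a set set \<Rightarrow> bool" where
  "planar P L \<longleftrightarrow>
     (\<forall>l\<in>L. \<forall>m\<in>L. l \<noteq> m \<and> l \<inter> m \<noteq> {} \<longrightarrow>
        (\<exists>!X. pls_plane P L X \<and> l \<subseteq> X \<and> m \<subseteq> X))"

definition pls_isomorphic ::
  "'a set \<Rightarrow> 'a set set \<Rightarrow> 'b set \<Rightarrow> 'b set set \<Rightarrow> bool" where
  "pls_isomorphic P L Q K \<longleftrightarrow> (\<exists>f. bij_betw f P Q \<and> (\<lambda>l. f ` l) ` L = K)"

locale affine_plane = partial_linear_space A M
  for A :: "'a set" and M :: "'a set set" +
  assumes linear: "linear_on M A"
    and parallel: "\<lbrakk>m \<in> M; a \<in> A; a \<notin> m\<rbrakk> \<Longrightarrow> \<exists>!n. n \<in> M \<and> a \<in> n \<and> n \<inter> m = {}"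
    and triangle: "\<exists>a\<in>A. \<exists>b\<in>A. \<exists>c\<in>A. a \<noteq> b \<and> a \<noteq> c \<and> b \<noteq> c \<and>
                     \<not> (\<exists>m\<in>M. a \<in> m \<and> b \<in> m \<and> c \<in> m)"

text \<open>The points of the dual of an affine plane are its lines; the lines of the
  dual are the following pencils.\<close>

definition pencils :: "'a set \<Rightarrow> 'a set set \<Rightarrow> 'a set set set" where
  "pencils A M = (\<lambda>a. {m\<in>M. a \<in> m}) ` A"

text \<open>Distinct points of an affine plane have distinct pencils. Hence, if the dual of an
  affine plane over any type is isomorphic to \<open>(P, L)\<close> with \<open>P :: 'a set\<close>, then each of its
  points may be replaced by the corresponding element of \<open>L :: 'a set set\<close>. Affine planes
  over the type \<open>'a set\<close> are therefore no restriction.\<close>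

definition isomorphic_to_dual_affine_plane :: "'a set \<Rightarrow> 'a set set \<Rightarrow> bool" where
  "isomorphic_to_dual_affine_plane P L \<longleftrightarrow>
     (\<exists>(A :: 'a set set) (M :: 'a set set set).
        affine_plane A M \<and> pls_isomorphic P L M (pencils A M))"

definition four_lines_in_six_points :: "'a set set \<Rightarrow> bool" where
  "four_lines_in_six_points L \<longleftrightarrow>
     (\<exists>l\<^sub>1\<in>L. \<exists>l\<^sub>2\<in>L. \<exists>l\<^sub>3\<in>L. \<exists>l\<^sub>4\<in>L. distinct [l\<^sub>1, l\<^sub>2, l\<^sub>3, l\<^sub>4] \<and>
        (\<exists>p\<^sub>1\<^sub>2 p\<^sub>1\<^sub>3 p\<^sub>1\<^sub>4 p\<^sub>2\<^sub>3 p\<^sub>2\<^sub>4 p\<^sub>3\<^sub>4.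
           l\<^sub>1 \<inter> l\<^sub>2 = {p\<^sub>1\<^sub>2} \<and> l\<^sub>1 \<inter> l\<^sub>3 = {p\<^sub>1\<^sub>3} \<and> l\<^sub>1 \<inter> l\<^sub>4 = {p\<^sub>1\<^sub>4} \<and>
           l\<^sub>2 \<inter> l\<^sub>3 = {p\<^sub>2\<^sub>3} \<and> l\<^sub>2 \<inter> l\<^sub>4 = {p\<^sub>2\<^sub>4} \<and> l\<^sub>3 \<inter> l\<^sub>4 = {p\<^sub>3\<^sub>4} \<and>
           distinct [p\<^sub>1\<^sub>2, p\<^sub>1\<^sub>3, p\<^sub>1\<^sub>4, p\<^sub>2\<^sub>3, p\<^sub>2\<^sub>4, p\<^sub>3\<^sub>4]))"

locale polar_space = partial_linear_space P L
  for P :: "'a set" and L :: "'a set set" +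
  assumes one_or_all: "\<lbrakk>p \<in> P; l \<in> L; p \<notin> l\<rbrakk> \<Longrightarrow>
    (\<exists>!q. q \<in> l \<and> pls_collinear L p q) \<or> (\<forall>q\<in>l. pls_collinear L p q)"

definition polar_perp :: "'a set \<Rightarrow> 'a set set \<Rightarrow> 'a set \<Rightarrow> 'a set" where
  "polar_perp P L X = {q\<in>P. \<forall>x\<in>X. q = x \<or> pls_collinear L q x}"

definition polar_nondegenerate :: "'a set \<Rightarrow> 'a set set \<Rightarrow> bool" where
  "polar_nondegenerate P L \<longleftrightarrow> \<not> (\<exists>p\<in>P. \<forall>q\<in>P. p = q \<or> pls_collinear L p q)"

text \<open>The rank is the maximal length of a chain of singular (that is, linear) subspaces,
  the empty subspace included.\<close>

definition polar_rank_ge :: "'a set \<Rightarrow> 'a set set \<Rightarrow> nat \<Rightarrow> bool" where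
  "polar_rank_ge P L n \<longleftrightarrow>
     (\<exists>C :: nat \<Rightarrow> 'a set. (\<forall>i\<le>n. pls_subspace P L (C i) \<and> linear_on L (C i)) \<and>
        (\<forall>i<n. C i \<subset> C (Suc i)))"

lemma (in partial_linear_space) polar_rank_ge_2_iff: "polar_rank_ge P L 2 \<longleftrightarrow> L \<noteq> {}"
proof
  assume "polar_rank_ge P L 2"
  then obtain C :: "nat \<Rightarrow> 'a set" where C: "\<forall>i\<le>2. linear_on L (C i)"
    and lt: "\<forall>i<2. C i \<subset> C (Suc i)"
    unfolding polar_rank_ge_def by blast
  from lt have "C 0 \<subset> C 1" "C 1 \<subset> C 2"
    by (auto simp: numeral_2_eq_2)
  then obtain x y where "x \<in> C 2" "y \<in> C 2" "x \<noteq> y" by blast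
  with C show "L \<noteq> {}" unfolding linear_on_def pls_collinear_def by blast
next
  assume "L \<noteq> {}"
  then obtain l where l: "l \<in> L" by blast
  obtain x y where xy: "x \<in> l" "y \<in> l" "x \<noteq> y" using line_two_points[OF l] by blast
  define C where "C = (\<lambda>i::nat. if i = 0 then {} else if i = 1 then {x} else l)"
  have "pls_subspace P L l"
    using line_subset[OF l] line_unique[OF l] unfolding pls_subspace_def by blast
  moreover have "linear_on L l" using l unfolding linear_on_def pls_collinear_def by blast
  moreover have "pls_subspace P L {x}" "pls_subspace P L {}"
    using line_subset[OF l] xy unfolding pls_subspace_def by auto
  moreover have "linear_on L {x}" "linear_on L {}" unfolding linear_on_def by auto
  ultimately have "\<forall>i\<le>2. pls_subspace P L (C i) \<and> linear_on L (C i)"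
    unfolding C_def by simp
  moreover have "\<forall>i<2. C i \<subset> C (Suc i)"
    using xy unfolding C_def by (auto simp: less_2_cases_iff)
  ultimately show "polar_rank_ge P L 2" unfolding polar_rank_ge_def by blast
qed

definition hyperbolic_lines :: "'a set \<Rightarrow> 'a set set \<Rightarrow> 'a set set" where
  "hyperbolic_lines P L =
     {polar_perp P L (polar_perp P L {x, y}) | x y.
        x \<in> P \<and> y \<in> P \<and> x \<noteq> y \<and> \<not> pls_collinear L x y}"

end

theory Submission
  imports Defs
begin

text \<open>The polar space lives on \<open>P\<close> itself: its lines are the sets \<open>{x, y}\<^sup>\<bottom>\<^sup>\<bottom>\<close> with \<open>x \<noteq> y\<close>
  non-collinear. In a dual affine plane \<open>X\<close>, perpendicularity is an equivalence relation whose
  classes meet every line of \<open>X\<close>. If \<open>u\<close> is perpendicular to two points of a class, it is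
  perpendicular to the whole class, since otherwise a linear plane on \<open>u\<close> would contain four lines
  meeting in six points. The main step constructs, for each point \<open>y\<close> of \<open>X\<close>, a point \<open>r\<close>
  perpendicular to \<open>X\<close> such that \<open>{y, r}\<^sup>\<bottom>\<close> is the perp of the class \<open>C\<close> of \<open>y\<close>. As \<open>r\<close> lies on the
  singular line \<open>C\<^sup>\<bottom>\<^sup>\<bottom>\<close>, every point has a perpendicular point on every singular line. Such points \<open>r\<close>
  also give the exchange property of singular lines, hence the ``one or all'' axiom.\<close>

section \<open>Collinearity and parallelism\<close>

lemma pls_perp_iff: "pls_perp L x y \<longleftrightarrow> \<not> pls_collinear L x y"
  unfolding pls_perp_def pls_collinear_def by blast

lemma pls_collinear_sym: "pls_collinear L x y \<longleftrightarrow> pls_collinear L y x"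
  unfolding pls_collinear_def by blast

lemma pls_collinear_irrefl [simp]: "\<not> pls_collinear L x x"
  unfolding pls_collinear_def by blast

lemma mem_pencils_iff: "k \<in> pencils A M \<longleftrightarrow> (\<exists>a\<in>A. k = {m\<in>M. a \<in> m})"
  unfolding pencils_def by (rule image_iff)

text \<open>If distinct \<open>k\<close> and \<open>m\<close> met in a point \<open>a\<close>, both
  would be parallels to \<open>l\<close> through \<open>a\<close>, against the uniqueness in
  \<open>parallel\<close>.\<close>

lemma (in affine_plane) parallel_trans:
  assumes "k \<in> M" "l \<in> M" "m \<in> M" "k = l \<or> k \<inter> l = {}" "l = m \<or> l \<inter> m = {}"
  shows "k = m \<or> k \<inter> m = {}"
proof (rule ccontr)
  assume *: "\<not> (k = m \<or> k \<inter> m = {})"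
  then obtain a where a: "a \<in> k" "a \<in> m" by blast
  have "k \<inter> l = {}" "m \<inter> l = {}" using * assms by auto
  moreover have "a \<in> A" using a(1) assms(1) line_subset by blast
  moreover have "a \<notin> l" using a \<open>k \<inter> l = {}\<close> by blast
  ultimately show False using parallel[of l a] a assms * by blast
qed

section \<open>Subspaces and planes\<close>

text \<open>The name \<open>onan\<close> refers to the O'Nan configuration: four lines meeting in
  six points.\<close>

locale hyperbolic_space = partial_linear_space P L for P :: "'a set" and L +
  assumes planar: "planar P L"
    and planes: "\<And>X. pls_plane P L X \<Longrightarrow>
          isomorphic_to_dual_affine_plane X (lines_in L X) \<or> linear_on L X"
    and onan: "\<And>X. pls_plane P L X \<Longrightarrow> linear_on L X \<Longrightarrow>
          \<not> four_lines_in_six_points (lines_in L X)"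
    and perp_inj: "\<And>x y. x \<in> P \<Longrightarrow> y \<in> P \<Longrightarrow> perp_set P L {x} \<subseteq> perp_set P L {y} \<Longrightarrow> x = y"
    and four_points: "\<And>l. l \<in> L \<Longrightarrow> infinite l \<or> card l \<ge> 4"
    and line_perp_perp: "\<And>l. l \<in> L \<Longrightarrow> perp_set P L (perp_set P L l) = l"
begin

abbreviation col (infix "\<sim>" 50) where "x \<sim> y \<equiv> pls_collinear L x y"

text \<open>By \<open>planes\<close>, a non-linear plane is a dual affine plane. In this form, one
  pair of distinct non-collinear points identifies it.\<close>

definition dual_plane :: "'a set \<Rightarrow> bool" where
  "dual_plane X \<longleftrightarrow> pls_plane P L X \<and> \<not> linear_on L X"

lemma colI: "l \<in> L \<Longrightarrow> x \<in> l \<Longrightarrow> y \<in> l \<Longrightarrow> x \<noteq> y \<Longrightarrow> x \<sim> y"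
  unfolding pls_collinear_def by blast

lemma colE:
  assumes "x \<sim> y" obtains l where "l \<in> L" "x \<in> l" "y \<in> l" "x \<noteq> y" "x \<in> P" "y \<in> P"
  using assms line_subset unfolding pls_collinear_def by blast

lemma col_sym: "x \<sim> y \<Longrightarrow> y \<sim> x"
  by (simp add: pls_collinear_sym)

lemma col_P: "x \<sim> y \<Longrightarrow> x \<in> P" "x \<sim> y \<Longrightarrow> y \<in> P"
  by (auto elim: colE)

lemma two_more_points:
  assumes "l \<in> L"
  obtains c d where "c \<in> l" "d \<in> l" "c \<noteq> d" "c \<notin> {a, b}" "d \<notin> {a, b}"
proof -
  have *: "\<not> l \<subseteq> {a, b, c}" for c
  proof
    assume "l \<subseteq> {a, b, c}"
    moreover have "card {a, b, c} \<le> 3" by (simp add: card_insert_if)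
    ultimately have "finite l" "card l \<le> 3"
      using finite_subset[of l "{a, b, c}"] card_mono[of "{a, b, c}" l] by auto
    then show False using four_points[OF assms] by auto
  qed
  obtain c where c: "c \<in> l" "c \<notin> {a, b}" using *[of a] by blast
  moreover obtain d where "d \<in> l" "d \<notin> {a, b}" "d \<noteq> c" using *[of c] by blast
  ultimately show ?thesis using that by blast
qed

lemma subspace_lineD:
  "\<lbrakk>pls_subspace P L X; l \<in> L; x \<in> l; y \<in> l; x \<noteq> y; x \<in> X; y \<in> X\<rbrakk> \<Longrightarrow> l \<subseteq> X"
  unfolding pls_subspace_def by blast

lemma generated_subspace:
  assumes "S \<subseteq> P" shows "pls_subspace P L (pls_generated P L S)"
  unfolding pls_subspace_def
proof (intro conjI ballI impI)
  have "pls_subspace P L P" using line_subset unfolding pls_subspace_def by blast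
  then show "pls_generated P L S \<subseteq> P" using assms unfolding pls_generated_def by blast
next
  fix l assume l: "l \<in> L"
    and "\<exists>x\<in>l \<inter> pls_generated P L S. \<exists>y\<in>l \<inter> pls_generated P L S. x \<noteq> y"
  then obtain x y where xy: "x \<in> l" "y \<in> l" "x \<noteq> y"
    "x \<in> pls_generated P L S" "y \<in> pls_generated P L S" by blast
  have "l \<subseteq> X" if "pls_subspace P L X" "S \<subseteq> X" for X
  proof -
    have "x \<in> X" "y \<in> X" using xy that unfolding pls_generated_def by blast+
    then show ?thesis using xy l that(1) unfolding pls_subspace_def by blast
  qed
  then show "l \<subseteq> pls_generated P L S" unfolding pls_generated_def by blast
qed

lemma generated_superset: "S \<subseteq> pls_generated P L S"
  unfolding pls_generated_def by blast

lemma line_int: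
  "\<lbrakk>l \<in> L; m \<in> L; l \<noteq> m; x \<in> l; x \<in> m\<rbrakk> \<Longrightarrow> l \<inter> m = {x}"
  using line_unique by blast

lemma plane_subspace: "pls_plane P L X \<Longrightarrow> pls_subspace P L X"
  unfolding pls_plane_def using generated_subspace line_subset by auto

lemma plane_ex1:
  assumes "l \<in> L" "m \<in> L" "l \<noteq> m" "l \<inter> m \<noteq> {}"
  shows "\<exists>!X. pls_plane P L X \<and> l \<subseteq> X \<and> m \<subseteq> X"
  using planar[unfolded planar_def, THEN bspec, THEN bspec, THEN mp, OF assms(1,2)] assms(3,4)
  by simp

lemma plane_unique:
  assumes "l \<in> L" "m \<in> L" "l \<noteq> m" "l \<inter> m \<noteq> {}"
    and "pls_plane P L X" "l \<subseteq> X" "m \<subseteq> X" "pls_plane P L Y" "l \<subseteq> Y" "m \<subseteq> Y"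
  shows "X = Y"
  using ex1E[OF plane_ex1[OF assms(1-4)]] assms(5-) by metis

lemma plane_ex:
  assumes "l \<in> L" "m \<in> L" "l \<noteq> m" "l \<inter> m \<noteq> {}"
  obtains X where "pls_plane P L X" "l \<subseteq> X" "m \<subseteq> X"
  using ex1_implies_ex[OF plane_ex1[OF assms]] that by blast

text \<open>The subspace generated by \<open>l\<close> and \<open>m\<close> is itself a plane on
  both lines, so it equals \<open>X\<close> by planarity.\<close>

lemma plane_least:
  assumes X: "pls_plane P L X" "l \<subseteq> X" "m \<subseteq> X"
    and lm: "l \<in> L" "m \<in> L" "l \<noteq> m" "l \<inter> m \<noteq> {}"
    and S: "pls_subspace P L S" "l \<subseteq> S" "m \<subseteq> S"
  shows "X \<subseteq> S"
proof -
  let ?G = "pls_generated P L (l \<union> m)"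
  have "pls_plane P L ?G" unfolding pls_plane_def using lm by blast
  moreover have "l \<subseteq> ?G" "m \<subseteq> ?G" using generated_superset by blast+
  ultimately have "X = ?G" using plane_unique[OF lm] X by blast
  moreover have "?G \<subseteq> S" unfolding pls_generated_def using S by blast
  ultimately show ?thesis by simp
qed

section \<open>The structure of dual affine planes\<close>

lemma dual_plane_iso:
  assumes "dual_plane X"
  obtains A :: "'a set set" and M f where "affine_plane A M" "bij_betw f X M"
    "(\<lambda>l. f ` l) ` lines_in L X = pencils A M"
proof -
  have "isomorphic_to_dual_affine_plane X (lines_in L X)"
    using assms planes[of X] unfolding dual_plane_def by blast
  then obtain A :: "'a set set" and M where AM: "affine_plane A M"
    and "pls_isomorphic X (lines_in L X) M (pencils A M)"
    unfolding isomorphic_to_dual_affine_plane_def by blast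
  from this(2) obtain f where "bij_betw f X M" "(\<lambda>l. f ` l) ` lines_in L X = pencils A M"
    unfolding pls_isomorphic_def by blast
  with AM show ?thesis by (rule that)
qed

lemma dual_plane_subspace: "dual_plane X \<Longrightarrow> pls_subspace P L X"
  unfolding dual_plane_def using plane_subspace by blast

lemma dual_plane_line:
  "\<lbrakk>dual_plane X; l \<in> L; x \<in> l; y \<in> l; x \<noteq> y; x \<in> X; y \<in> X\<rbrakk> \<Longrightarrow> l \<subseteq> X"
  using dual_plane_subspace subspace_lineD by blast

lemma dual_plane_P: "dual_plane X \<Longrightarrow> x \<in> X \<Longrightarrow> x \<in> P"
  using dual_plane_subspace unfolding pls_subspace_def by blast

text \<open>In the affine plane, \<open>l\<close> and \<open>m\<close> are the pencils of two points
  \<open>a\<close> and \<open>b\<close>; an affine line on both points is a common member.\<close>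

lemma dual_plane_meet:
  assumes X: "dual_plane X" and l: "l \<in> L" "l \<subseteq> X" and m: "m \<in> L" "m \<subseteq> X"
  obtains x where "x \<in> l" "x \<in> m"
proof -
  obtain A :: "'a set set" and M f where af: "affine_plane A M" and f: "bij_betw f X M"
    and pen: "(\<lambda>l. f ` l) ` lines_in L X = pencils A M"
    by (rule dual_plane_iso[OF X])
  interpret af: affine_plane A M by (rule af)
  have "f ` l \<in> pencils A M" "f ` m \<in> pencils A M"
    using l m pen unfolding lines_in_def by blast+
  then obtain a b where a: "a \<in> A" "f ` l = {k\<in>M. a \<in> k}" and b: "b \<in> A" "f ` m = {k\<in>M. b \<in> k}"
    unfolding mem_pencils_iff by meson
  have "\<exists>k\<in>M. a \<in> k \<and> b \<in> k"
  proof (cases "a = b")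
    case True
    obtain x where "x \<in> l" using line_two_points[OF l(1)] by blast
    then have "f x \<in> {k\<in>M. a \<in> k}" using a by blast
    with True show ?thesis by blast
  next
    case False
    then show ?thesis using af.linear a b unfolding linear_on_def pls_collinear_def by blast
  qed
  then have "f ` l \<inter> f ` m \<noteq> {}" unfolding a b by blast
  then have "l \<inter> m \<noteq> {}"
    using inj_on_image_Int[of f X l m] f l m unfolding bij_betw_def by (metis image_empty)
  then show ?thesis using that by blast
qed

text \<open>A line of \<open>X\<close> through \<open>x\<close> and \<open>y\<close> is the pencil
  of an affine point on both \<open>f x\<close> and \<open>f y\<close>, so non-collinearity becomes
  parallelism.\<close>

lemma dual_plane_perp_iff:
  assumes X: "dual_plane X" and f: "bij_betw f X M"
    and pen: "(\<lambda>l. f ` l) ` lines_in L X = pencils A M" and af: "affine_plane A M"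
    and xy: "x \<in> X" "y \<in> X"
  shows "\<not> x \<sim> y \<longleftrightarrow> f x = f y \<or> f x \<inter> f y = {}"
proof -
  interpret af: affine_plane A M by (rule af)
  have fM: "f x \<in> M" "f y \<in> M" using f xy unfolding bij_betw_def by auto
  have eq: "f x = f y \<longleftrightarrow> x = y" using f xy unfolding bij_betw_def inj_on_def by blast
  have "f x \<inter> f y \<noteq> {}" if "x \<sim> y"
  proof -
    from that obtain l where l: "l \<in> L" "x \<in> l" "y \<in> l" "x \<noteq> y" by (rule colE)
    then have "l \<in> lines_in L X" using dual_plane_line[OF X l] xy unfolding lines_in_def by blast
    then have "f ` l \<in> pencils A M" using pen by blast
    then show ?thesis using l unfolding mem_pencils_iff by blast
  qed
  moreover have "x \<sim> y" if ne: "x \<noteq> y" and a: "a \<in> f x" "a \<in> f y" for a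
  proof -
    have "a \<in> A" using a fM af.line_subset by blast
    then have "{k\<in>M. a \<in> k} \<in> (\<lambda>l. f ` l) ` lines_in L X"
      unfolding pen mem_pencils_iff by blast
    then obtain l where l: "{k\<in>M. a \<in> k} = f ` l" "l \<in> lines_in L X" by (rule imageE)
    then have lX: "l \<subseteq> X" and "l \<in> L" unfolding lines_in_def by auto
    have "f x \<in> f ` l" "f y \<in> f ` l" unfolding l(1)[symmetric] using a fM by simp_all
    then have "x \<in> l" "y \<in> l"
      using lX f xy inj_on_image_mem_iff[of f X] unfolding bij_betw_def by blast+
    with \<open>l \<in> L\<close> ne show ?thesis by (blast intro: colI)
  qed
  ultimately show ?thesis using eq by auto
qed

lemma dual_plane_perp_trans:
  assumes X: "dual_plane X" and "x \<in> X" "y \<in> X" "z \<in> X" "\<not> x \<sim> y" "\<not> y \<sim> z"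
  shows "\<not> x \<sim> z"
proof -
  obtain A :: "'a set set" and M f where af: "affine_plane A M" and f: "bij_betw f X M"
    and pen: "(\<lambda>l. f ` l) ` lines_in L X = pencils A M"
    by (rule dual_plane_iso[OF X])
  note iff = dual_plane_perp_iff[OF X f pen af]
  have "f x \<in> M" "f y \<in> M" "f z \<in> M" using f assms(2-4) unfolding bij_betw_def by auto
  then show ?thesis
    using affine_plane.parallel_trans[OF af, of "f x" "f y" "f z"] iff assms(2-) by blast
qed

text \<open>The line is the pencil of some affine point \<open>a\<close>, and it contains the
  parallel to \<open>f p\<close> through \<open>a\<close>.\<close>

lemma dual_plane_class_meets_line:
  assumes X: "dual_plane X" and p: "p \<in> X" and l: "l \<in> L" "l \<subseteq> X"
  obtains q where "q \<in> l" "\<not> q \<sim> p"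
proof -
  obtain A :: "'a set set" and M f where af: "affine_plane A M" and f: "bij_betw f X M"
    and pen: "(\<lambda>l. f ` l) ` lines_in L X = pencils A M"
    by (rule dual_plane_iso[OF X])
  interpret af: affine_plane A M by (rule af)
  have "f ` l \<in> pencils A M" using l pen unfolding lines_in_def by blast
  then obtain a where a: "a \<in> A" "f ` l = {k\<in>M. a \<in> k}" unfolding mem_pencils_iff by blast
  have fp: "f p \<in> M" using f p unfolding bij_betw_def by auto
  have "\<exists>n\<in>M. a \<in> n \<and> (n = f p \<or> n \<inter> f p = {})"
  proof (cases "a \<in> f p")
    case False
    show ?thesis using ex1_implies_ex[OF af.parallel[OF fp a(1) False]] by blast
  qed (use fp in blast)
  then obtain n where n: "n \<in> M" "a \<in> n" "n = f p \<or> n \<inter> f p = {}" by blast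
  then have "n \<in> f ` l" unfolding a(2) by simp
  then obtain q where q: "n = f q" "q \<in> l" by (rule imageE)
  with n(3) have "\<not> q \<sim> p" using dual_plane_perp_iff[OF X f pen af, of q p] l p by blast
  with q show ?thesis using that by blast
qed

lemma dual_plane_ex:
  assumes "p \<sim> a" "p \<sim> b" "\<not> a \<sim> b" "a \<noteq> b"
  obtains X where "dual_plane X" "p \<in> X" "a \<in> X" "b \<in> X"
proof -
  from assms obtain l where l: "l \<in> L" "p \<in> l" "a \<in> l" by (blast elim: colE)
  from assms obtain m where m: "m \<in> L" "p \<in> m" "b \<in> m" by (blast elim: colE)
  have "l \<noteq> m" using l m assms by (blast intro: colI)
  then obtain X where X: "pls_plane P L X" "l \<subseteq> X" "m \<subseteq> X"
    using plane_ex l m by (metis IntI empty_iff)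
  then have "\<not> linear_on L X" using l m assms unfolding linear_on_def by blast
  then show ?thesis using that X l m unfolding dual_plane_def by blast
qed

section \<open>Perpendicularity and the classes of a dual affine plane\<close>

text \<open>If \<open>p\<close> were collinear with \<open>z\<close>, then \<open>p\<close> and the
  line \<open>l\<close> would lie in a dual plane, where transitivity through \<open>p\<close> would
  make \<open>x\<close> and \<open>y\<close> perpendicular.\<close>

lemma perp_line:
  assumes l: "l \<in> L" "x \<in> l" "y \<in> l" "z \<in> l" "x \<noteq> y" and p: "\<not> p \<sim> x" "\<not> p \<sim> y"
  shows "\<not> p \<sim> z"
proof
  assume pz: "p \<sim> z"
  have "z \<sim> x" using l pz p by (blast intro: colI)
  moreover have "p \<noteq> x" using l p by (blast intro: colI)
  ultimately obtain X where X: "dual_plane X" "z \<in> X" "p \<in> X" "x \<in> X"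
    using dual_plane_ex[of z p x] pz p col_sym by blast
  have "z \<noteq> x" using pz p by blast
  then have "y \<in> X" using dual_plane_line[OF X(1) l(1,4,2)] X l by blast
  then have "\<not> x \<sim> y" using dual_plane_perp_trans[OF X(1)] X p col_sym by blast
  then show False using l by (blast intro: colI)
qed

lemma perp_subspace: "pls_subspace P L {w \<in> P. \<not> u \<sim> w}"
  unfolding pls_subspace_def
proof (intro conjI ballI impI)
  fix l assume l: "l \<in> L"
    and "\<exists>x\<in>l \<inter> {w \<in> P. \<not> u \<sim> w}. \<exists>y\<in>l \<inter> {w \<in> P. \<not> u \<sim> w}. x \<noteq> y"
  then obtain x y where "x \<in> l" "y \<in> l" "x \<noteq> y" "\<not> u \<sim> x" "\<not> u \<sim> y" by blast
  then show "l \<subseteq> {w \<in> P. \<not> u \<sim> w}" using perp_line[OF l] line_subset[OF l] by blast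
qed blast

text \<open>The lines \<open>xy\<close> and \<open>yz\<close> generate \<open>X\<close>, and the
  points perpendicular to \<open>u\<close> form a subspace containing both.\<close>

lemma perp_dual_plane:
  assumes X: "dual_plane X" and xyz: "x \<in> X" "y \<in> X" "z \<in> X" "x \<sim> y" "\<not> x \<sim> z" "x \<noteq> z"
    and u: "\<not> u \<sim> x" "\<not> u \<sim> y" "\<not> u \<sim> z" and w: "w \<in> X"
  shows "\<not> u \<sim> w"
proof -
  have "y \<sim> z" using dual_plane_perp_trans[OF X, of x z y] xyz col_sym by blast
  then obtain m where m: "m \<in> L" "y \<in> m" "z \<in> m" "y \<noteq> z" by (blast elim: colE)
  obtain l where l: "l \<in> L" "x \<in> l" "y \<in> l" "x \<noteq> y" using xyz(4) by (blast elim: colE)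
  have "l \<noteq> m" using l m xyz by (blast intro: colI)
  have lX: "l \<subseteq> X" "m \<subseteq> X" using dual_plane_line[OF X] l m xyz by blast+
  let ?S = "{w \<in> P. \<not> u \<sim> w}"
  have "l \<subseteq> ?S" "m \<subseteq> ?S" using l m u perp_line line_subset by blast+
  then have "X \<subseteq> ?S"
    using plane_least[of X l m ?S] X lX l m \<open>l \<noteq> m\<close> perp_subspace unfolding dual_plane_def by blast
  with w show ?thesis by blast
qed

text \<open>If \<open>c\<close> is off a line \<open>l\<close> of \<open>X\<close>, only one point
  of \<open>l\<close> is perpendicular to \<open>c\<close>, so \<open>c\<close> can be joined to
  another one.\<close>

lemma line_in_plane_through:
  assumes X: "dual_plane X" "c \<in> X"
  obtains n where "n \<in> L" "n \<subseteq> X" "c \<in> n"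
proof -
  obtain l where l: "l \<in> L" "l \<subseteq> X"
    using X(1) generated_superset unfolding dual_plane_def pls_plane_def
    by (metis Un_subset_iff)
  show ?thesis
  proof (cases "c \<in> l")
    case False
    obtain q where q: "q \<in> l" "\<not> q \<sim> c" using dual_plane_class_meets_line[OF X l] by blast
    obtain d where d: "d \<in> l" "d \<noteq> q" using line_two_points[OF l(1)] by blast
    then have "d \<sim> c"
      using perp_line[OF l(1) q(1) d(1)] dual_plane_perp_trans[OF X(1), of q c d] q l X col_sym
      by (meson colI subsetD)
    then obtain n where "n \<in> L" "d \<in> n" "c \<in> n" "d \<noteq> c" by (blast elim: colE)
    then show ?thesis using that dual_plane_line[OF X(1)] X d l by blast
  qed (use l that in blast)
qed

text \<open>Condition \<open>onan\<close> enters only here. If \<open>u\<close> were collinear with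
  \<open>c\<close>, the points \<open>a\<close> and \<open>b\<close> would lead to two lines
  \<open>k\<close> and \<open>k'\<close> on \<open>u\<close> in a linear plane.\<close>

lemma perp_class:
  assumes X: "dual_plane X" and abc: "a \<in> X" "b \<in> X" "c \<in> X" "\<not> a \<sim> b" "\<not> a \<sim> c" "a \<noteq> b"
    and ua: "\<not> u \<sim> a" and ub: "\<not> u \<sim> b"
  shows "\<not> u \<sim> c"
proof
  assume uc: "u \<sim> c"
  note tr = dual_plane_perp_trans[OF X]
  \<comment> \<open>If \<open>e\<close> were collinear with \<open>a\<close>, then \<open>u\<close>
    would be perpendicular to the triangle \<open>a\<close>, \<open>e\<close>, \<open>b\<close>,
    hence to all of \<open>X\<close>, against \<open>uc\<close>.\<close>
  have cls: "\<not> a \<sim> e" if e: "e \<in> X" "\<not> u \<sim> e" for e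
    using perp_dual_plane[OF X abc(1) e(1) abc(2) _ abc(4,6) ua e(2) ub abc(3)] uc by blast
  have uX: "u \<notin> X"
    using tr[of c a u] uc ua abc col_sym by blast
  obtain n where n: "n \<in> L" "n \<subseteq> X" "c \<in> n" by (rule line_in_plane_through[OF X abc(3)])
  obtain e0 where e0: "e0 \<in> n" "e0 \<noteq> c" using line_two_points[OF n(1)] by blast
  have e0c: "e0 \<sim> c" using e0 n by (blast intro: colI)
  have e0X: "e0 \<in> X" using e0 n by blast
  \<comment> \<open>The aim up to \<open>e1n\<close> is a point \<open>e1\<close> off
    \<open>n\<close> in the class of \<open>e0\<close>. It is found on the line joining
    \<open>c\<close> to a third point \<open>h\<close> of the line \<open>a e0\<close>.\<close>
  have ae0: "a \<sim> e0" using tr[of c a e0] e0c e0X abc col_sym by blast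
  then obtain m0 where m0: "m0 \<in> L" "a \<in> m0" "e0 \<in> m0" "a \<noteq> e0" by (blast elim: colE)
  have m0X: "m0 \<subseteq> X" using dual_plane_line[OF X] m0 e0X abc by blast
  have "a \<notin> n" using n abc uc ua by (blast intro: colI)
  obtain h where h: "h \<in> m0" "h \<noteq> a" "h \<noteq> e0" using two_more_points[OF m0(1), of a e0] by blast
  have hX: "h \<in> X" using h m0X by blast
  have ch: "c \<sim> h" using tr[of a c h] h hX abc colI[OF m0(1,2) h(1)] by blast
  obtain m1 where m1: "m1 \<in> L" "c \<in> m1" "h \<in> m1" "c \<noteq> h" using ch by (blast elim: colE)
  have m1X: "m1 \<subseteq> X" using dual_plane_line[OF X] m1 hX abc by blast
  obtain e1 where e1: "e1 \<in> m1" "\<not> e1 \<sim> e0" using dual_plane_class_meets_line[OF X e0X m1(1) m1X] .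
  have e1X: "e1 \<in> X" using e1 m1X by blast
  have "h \<notin> n" using h m0 n e0 \<open>a \<notin> n\<close> line_unique[OF m0(1) n(1) h(3)] by blast
  then have "m1 \<noteq> n" using m1 by blast
  have "e1 \<noteq> c" using e1 e0c col_sym by blast
  have "e1 \<noteq> e0" using line_unique[OF m1(1) n(1) e0(2)] \<open>m1 \<noteq> n\<close> m1 n e0 e1 by blast
  have e1n: "e1 \<notin> n" using e1 \<open>e1 \<noteq> e0\<close> n e0 by (blast intro: colI)
  \<comment> \<open>The lines \<open>n\<close>, \<open>uf\<close>, \<open>uf'\<close> (for \<open>a' = a\<close> and \<open>a' = b\<close>) and the points perpendicular to \<open>e1\<close> in
    \<open>\<langle>u, n\<rangle>\<close>, which form a line, are the forbidden configuration.\<close>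
  have sec: "\<exists>f l v k. f \<in> n \<and> f \<sim> e1 \<and> l \<in> L \<and> l \<subseteq> X \<and> a' \<in> l \<and> e1 \<in> l \<and> f \<in> l \<and>
      k \<in> L \<and> u \<in> k \<and> f \<in> k \<and> v \<in> k \<and> \<not> e1 \<sim> v \<and> v \<notin> X \<and> v \<noteq> u"
    if a': "a' \<in> X" "\<not> a \<sim> a'" "\<not> u \<sim> a'" for a'
  proof -
    have "\<not> c \<sim> a'" using tr[of c a a'] a' abc col_sym by blast
    have "c \<sim> e1" using e1 m1 \<open>e1 \<noteq> c\<close> by (blast intro: colI)
    then have a'e1: "a' \<sim> e1" using tr[of c a' e1] \<open>\<not> c \<sim> a'\<close> e1X a' abc by blast
    then obtain l where l: "l \<in> L" "a' \<in> l" "e1 \<in> l" "a' \<noteq> e1" by (blast elim: colE)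
    have lX: "l \<subseteq> X" using dual_plane_line[OF X] l a' e1X by blast
    obtain f where f: "f \<in> l" "f \<in> n" using dual_plane_meet[OF X l(1) lX n(1,2)] .
    have fe1: "f \<sim> e1" using f e1n l by (blast intro: colI)
    have "a' \<notin> n" using \<open>\<not> c \<sim> a'\<close> n uc a' by (blast intro: colI)
    then have fa': "f \<sim> a'" using f l by (blast intro: colI)
    have fX: "f \<in> X" using f n by blast
    have uf: "u \<sim> f" using cls[of f] fX fa' tr[of f a a'] a' abc col_sym by blast
    have "u \<noteq> a'" using a' uX by blast
    \<comment> \<open>This plane is dual because \<open>u\<close> is perpendicular to
      \<open>a'\<close>. It contains \<open>l\<close>, hence \<open>e1\<close>, so the line
      \<open>uf\<close> has a point \<open>v\<close> perpendicular to \<open>e1\<close>.\<close>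
    then obtain Y where Y: "dual_plane Y" "f \<in> Y" "u \<in> Y" "a' \<in> Y"
      using dual_plane_ex[of f u a'] uf fa' a' col_sym by blast
    obtain k where k: "k \<in> L" "u \<in> k" "f \<in> k" "u \<noteq> f" using uf by (blast elim: colE)
    have kY: "k \<subseteq> Y" using dual_plane_line[OF Y(1)] k Y by blast
    have "l \<subseteq> Y" using dual_plane_line[OF Y(1) l(1,2) f(1)] fa' Y by fastforce
    then have "e1 \<in> Y" using l by blast
    then obtain v where v: "v \<in> k" "\<not> v \<sim> e1" using dual_plane_class_meets_line[OF Y(1) _ k(1) kY] by blast
    have "v \<noteq> f" using v fe1 by blast
    then have "v \<notin> X" using dual_plane_line[OF X k(1) v(1) k(3)] fX k uX by blast
    have "v \<noteq> u" using cls[OF e1X] v tr[of c a e1] \<open>c \<sim> e1\<close> abc e1X col_sym by blast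
    then show ?thesis using f fe1 l lX k v \<open>v \<notin> X\<close> col_sym by blast
  qed
  obtain f l v k where f: "f \<in> n" "f \<sim> e1" "l \<in> L" "l \<subseteq> X" "a \<in> l" "e1 \<in> l" "f \<in> l"
      "k \<in> L" "u \<in> k" "f \<in> k" "v \<in> k" "\<not> e1 \<sim> v" "v \<notin> X" "v \<noteq> u"
    using sec[of a] abc ua by auto
  obtain f' l' v' k' where f': "f' \<in> n" "f' \<sim> e1" "l' \<in> L" "l' \<subseteq> X" "b \<in> l'" "e1 \<in> l'" "f' \<in> l'"
      "k' \<in> L" "u \<in> k'" "f' \<in> k'" "v' \<in> k'" "\<not> e1 \<sim> v'" "v' \<notin> X" "v' \<noteq> u"
    using sec[of b] abc ub by blast
  have fX: "f \<in> X" "f' \<in> X" using f f' n by blast+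
  have ff': "f \<noteq> f'"
  proof
    assume "f = f'"
    moreover have "f \<noteq> e1" using f by auto
    ultimately have "l = l'" using line_unique f f' by metis
    then show False using colI[OF f(3,5), of b] f'(5) abc by blast
  qed
  have kk': "k \<noteq> k'" using ff' f f' n uX by (metis line_unique subsetD)
  have kn: "k \<noteq> n" "k' \<noteq> n" using f f' n uX by blast+
  have int: "k \<inter> k' = {u}" "k \<inter> n = {f}" "k' \<inter> n = {f'}"
    using line_int[OF f(8) f'(8) kk' f(9) f'(9)] line_int[OF f(8) n(1) kn(1) f(10,1)]
      line_int[OF f'(8) n(1) kn(2) f'(10,1)] by blast+
  obtain Z where Z: "pls_plane P L Z" "n \<subseteq> Z" "k \<subseteq> Z"
    using plane_ex[OF n(1) f(8)] kn int by blast
  have Zs: "pls_subspace P L Z" using Z plane_subspace by blast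
  \<comment> \<open>In a dual plane, \<open>n\<close> would carry a point perpendicular to
    \<open>u\<close>. By \<open>cls\<close> it lies in the class of \<open>c\<close>, so it is
    \<open>c\<close> itself, against \<open>uc\<close>.\<close>
  have "linear_on L Z"
  proof (rule ccontr)
    assume "\<not> linear_on L Z"
    then have "dual_plane Z" using Z unfolding dual_plane_def by blast
    then obtain g where g: "g \<in> n" "\<not> g \<sim> u"
      using dual_plane_class_meets_line[of Z u n] Z n f by blast
    then have "\<not> a \<sim> g" using cls[of g] n col_sym by blast
    then have "\<not> c \<sim> g" using tr[of c a g] g n abc col_sym by blast
    then show False using g n uc col_sym by (metis colI)
  qed
  have k'Z: "k' \<subseteq> Z" using subspace_lineD[OF Zs f'(8,9,10)] fX uX f f' Z n by blast
  have e0v: "e0 \<noteq> v" "e0 \<noteq> v'" "v \<noteq> v'" using e0X f f' int by auto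
  have in_Z: "e0 \<in> Z" "v \<in> Z" "v' \<in> Z" using e0 Z k'Z f f' by blast+
  have "e0 \<sim> v" "e0 \<sim> v'" using \<open>linear_on L Z\<close> in_Z e0v unfolding linear_on_def by blast+
  then obtain g g' where g: "g \<in> L" "e0 \<in> g" "v \<in> g" and g': "g' \<in> L" "e0 \<in> g'" "v' \<in> g'"
    by (blast elim: colE)
  have gZ: "g \<subseteq> Z" "g' \<subseteq> Z" using subspace_lineD[OF Zs] g g' e0v in_Z by blast+
  have perp_g: "\<not> e1 \<sim> w" if "w \<in> g \<union> g'" for w
    using that perp_line[OF g(1)] perp_line[OF g'(1)] g g' e0v e1 f f' col_sym by blast
  \<comment> \<open>Both lines are perpendicular to \<open>e1\<close>. If distinct, they would
    generate \<open>Z\<close>, but \<open>f\<close> in \<open>Z\<close> is collinear with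
    \<open>e1\<close>.\<close>
  have "g = g'"
  proof (rule ccontr)
    assume "g \<noteq> g'"
    moreover have "g \<union> g' \<subseteq> {w \<in> P. \<not> e1 \<sim> w}" using perp_g g g' line_subset by blast
    ultimately have "Z \<subseteq> {w \<in> P. \<not> e1 \<sim> w}"
      using plane_least[OF Z(1) gZ g(1) g'(1)] perp_subspace g g' by blast
    then show False using f Z col_sym by blast
  qed
  have f_not_g: "f \<notin> g" "f' \<notin> g" using perp_g f f' col_sym by blast+
  have gne: "g \<noteq> n" "g \<noteq> k" "g \<noteq> k'" using f_not_g f f' by blast+
  have int': "n \<inter> g = {e0}" "k \<inter> g = {v}" "k' \<inter> g = {v'}"
    using line_int[OF n(1) g(1) _ e0(1) g(2)] line_int[OF f(8) g(1) _ f(11) g(3)]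
      line_int[OF f'(8) g(1) _ f'(11)] g'(3) \<open>g = g'\<close> gne by blast+
  have lines: "n \<in> lines_in L Z" "k \<in> lines_in L Z" "k' \<in> lines_in L Z" "g \<in> lines_in L Z"
    using n f f' g Z k'Z gZ unfolding lines_in_def by auto
  have "distinct [n, k, k', g]" using kn kk' gne by auto
  moreover have "distinct [f, f', e0, u, v, v']"
    using ff' f_not_g g e0v f f' fX e0X uX by auto
  moreover have "n \<inter> k = {f}" "n \<inter> k' = {f'}" using int by blast+
  ultimately have "four_lines_in_six_points (lines_in L Z)"
    unfolding four_lines_in_six_points_def using lines int int' by blast
  then show False using onan[OF Z(1) \<open>linear_on L Z\<close>] by blast
qed

section \<open>More points and lines in dual affine planes, and points perpendicular to them\<close>

lemma col_off_perp:
  "\<lbrakk>l \<in> L; x \<in> l; y \<in> l; z \<in> l; \<not> p \<sim> x; p \<sim> y; z \<noteq> x\<rbrakk> \<Longrightarrow> p \<sim> z"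
  using perp_line by blast

lemma class_col:
  "\<lbrakk>dual_plane X; a \<in> X; b \<in> X; c \<in> X; \<not> a \<sim> b; a \<sim> c\<rbrakk> \<Longrightarrow> b \<sim> c"
  using dual_plane_perp_trans by blast

text \<open>Non-linearity gives two points \<open>a\<close>, \<open>b\<close> of one class. If
  \<open>y\<close> is outside it, the line joining \<open>b\<close> to a third point of the line
  \<open>ya\<close> meets the class of \<open>y\<close> in a new point.\<close>

lemma second_class_point:
  assumes X: "dual_plane X" and y: "y \<in> X"
  obtains x where "x \<in> X" "x \<noteq> y" "\<not> x \<sim> y"
proof -
  obtain a b where ab: "a \<in> X" "b \<in> X" "a \<noteq> b" "\<not> a \<sim> b"
    using X unfolding dual_plane_def linear_on_def by blast
  show ?thesis
  proof (cases "y \<sim> a")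
    case False
    then show ?thesis using that[of a] that[of b] ab col_sym by blast
  next
    case True
    then obtain l where l: "l \<in> L" "y \<in> l" "a \<in> l" by (rule colE)
    obtain c where c: "c \<in> l" "c \<notin> {y, a}" using two_more_points[OF l(1)] by metis
    have "b \<sim> y" using class_col[OF X ab(1,2) y ab(4)] True col_sym by blast
    then have "b \<sim> c" using col_off_perp[OF l(1,3,2) c(1)] ab c col_sym by blast
    then obtain g where g: "g \<in> L" "b \<in> g" "c \<in> g" "b \<noteq> c" by (rule colE)
    have "y \<noteq> a" using True by auto
    then have "l \<subseteq> X" using dual_plane_line[OF X l _ y ab(1)] by blast
    then have "g \<subseteq> X" using dual_plane_line[OF X g] ab c by blast
    then obtain z where z: "z \<in> g" "\<not> z \<sim> y" using dual_plane_class_meets_line[OF X y g(1)] by blast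
    have "z \<noteq> y"
    proof
      assume "z = y"
      then have "g = l" using line_unique[OF g(1) l(1), of y c] z g l c by blast
      then show False using colI[OF g(1), of a b] g l ab by blast
    qed
    then show ?thesis using that z \<open>g \<subseteq> X\<close> by blast
  qed
qed

text \<open>A line \<open>g\<close> of \<open>X\<close> avoiding both \<open>q\<close> and
  \<open>x\<close> meets their class in a third point. It is built as the line joining
  \<open>d1\<close> to a point \<open>e\<close> of the line \<open>q d2\<close>.\<close>

lemma third_class_point:
  assumes X: "dual_plane X" and qx: "q \<in> X" "x \<in> X" "q \<noteq> x" "\<not> q \<sim> x"
  obtains z where "z \<in> X" "z \<noteq> q" "z \<noteq> x" "\<not> z \<sim> q" "\<not> z \<sim> x"
proof -
  obtain m where m: "m \<in> L" "m \<subseteq> X" "x \<in> m" by (rule line_in_plane_through[OF X qx(2)])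
  have qm: "q \<notin> m" using colI[OF m(1), of q x] m qx by blast
  obtain d1 d2 where d: "d1 \<in> m" "d2 \<in> m" "d1 \<noteq> d2" "d1 \<notin> {x, x}" "d2 \<notin> {x, x}"
    by (rule two_more_points[OF m(1)])
  have qd: "q \<sim> d" if "d \<in> m" "d \<noteq> x" for d
    using class_col[OF X qx(2,1), of d] colI[OF m(1,3), of d] that m qx col_sym by blast
  then obtain k where k: "k \<in> L" "q \<in> k" "d2 \<in> k" "q \<noteq> d2" using d by (metis colE insert_iff)
  have kX: "k \<subseteq> X" using dual_plane_line[OF X k] qx d m by blast
  obtain e1 e2 where e12: "e1 \<in> k" "e2 \<in> k" "e1 \<noteq> e2" "e1 \<notin> {q, d2}" "e2 \<notin> {q, d2}"
    by (rule two_more_points[OF k(1)])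
  \<comment> \<open>At most one point of \<open>k\<close> is perpendicular to \<open>d1\<close>; the
    fourth point of \<open>k\<close> provides a second candidate.\<close>
  have "d1 \<sim> e1 \<or> d1 \<sim> e2"
    using perp_line[OF k(1) e12(1,2) k(2) e12(3), of d1] qd[of d1] d col_sym by blast
  then obtain e where e: "e \<in> k" "e \<noteq> q" "e \<noteq> d2" "d1 \<sim> e" using e12 by blast
  from e(4) obtain g where g: "g \<in> L" "d1 \<in> g" "e \<in> g" "d1 \<noteq> e" by (rule colE)
  have gX: "g \<subseteq> X" using dual_plane_line[OF X g] e kX d m by blast
  obtain z where z: "z \<in> g" "\<not> z \<sim> q" using dual_plane_class_meets_line[OF X qx(1) g(1) gX] .
  have km: "k \<noteq> m" using qm k by blast
  have "d1 \<notin> k" using line_unique[OF k(1) m(1) d(3)] km d k by blast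
  have "q \<notin> g" using line_unique[OF g(1) k(1) e(2)] g e k \<open>d1 \<notin> k\<close> by blast
  have "e \<notin> m" using line_unique[OF k(1) m(1) e(3)] km d k e by blast
  have "x \<notin> g" using line_unique[OF g(1) m(1), of x d1] g d m \<open>e \<notin> m\<close> by blast
  have "z \<in> X" using z gX by blast
  have "\<not> z \<sim> x" using dual_plane_perp_trans[OF X \<open>z \<in> X\<close> qx(1,2) z(2) qx(4)] .
  then show ?thesis using that z \<open>z \<in> X\<close> \<open>q \<notin> g\<close> \<open>x \<notin> g\<close> by blast
qed

text \<open>With \<open>y\<close> a second point in the class of \<open>x\<close>, a third point of
  a line joining \<open>y\<close> to \<open>n\<close> is off \<open>n\<close>; join it to
  \<open>x\<close>.\<close>

lemma second_line_through:
  assumes X: "dual_plane X" and n: "n \<in> L" "n \<subseteq> X" "x \<in> n"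
  obtains m where "m \<in> L" "m \<subseteq> X" "x \<in> m" "m \<noteq> n"
proof -
  have xX: "x \<in> X" using n by blast
  obtain y where y: "y \<in> X" "y \<noteq> x" "\<not> y \<sim> x" by (rule second_class_point[OF X xX])
  obtain d where d: "d \<in> n" "d \<noteq> x" using line_two_points[OF n(1)] by blast
  have xd: "x \<sim> d" using colI[OF n(1,3)] d by blast
  have yn: "y \<notin> n" using colI[OF n(1), of y x] y n by blast
  have "y \<sim> d" using class_col[OF X xX y(1), of d] xd y d n col_sym by blast
  then obtain h where h: "h \<in> L" "y \<in> h" "d \<in> h" "y \<noteq> d" by (rule colE)
  have hX: "h \<subseteq> X" using dual_plane_line[OF X h] y d n by blast
  obtain e where e: "e \<in> h" "e \<notin> {y, d}" using two_more_points[OF h(1)] by metis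
  have "x \<sim> e" using col_off_perp[OF h(1,2,3) e(1)] y xd e col_sym by blast
  then obtain m where m: "m \<in> L" "x \<in> m" "e \<in> m" "x \<noteq> e" by (rule colE)
  have "m \<subseteq> X" using dual_plane_line[OF X m] xX e hX by blast
  moreover have "e \<notin> n" using line_unique[OF h(1) n(1), of e d] e h d yn by blast
  ultimately show ?thesis using that m by blast
qed

text \<open>Let \<open>n\<close>, \<open>m\<close> be two lines of \<open>X\<close> on a further point \<open>x\<close> of the class \<open>C\<close> of \<open>y\<close>. Since \<open>n\<^sup>\<bottom>\<^sup>\<bottom> = n\<close>,
  some \<open>q\<close> is perpendicular to \<open>n\<close> but not to \<open>y\<close>; let \<open>q2\<close> be a third point of the class of \<open>q\<close> and \<open>x\<close>
  in the plane \<open>\<langle>q, m\<rangle>\<close>. For all but at most one \<open>k\<close> on the line \<open>qy\<close>, the line \<open>q2 k\<close> meets \<open>C\<close> in a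
  point \<open>y2\<close> other than \<open>x\<close> and \<open>y\<close> (at the exceptional \<open>k\<close> it meets the perp of \<open>X\<close>, in \<open>\<rho>\<close>).
  In the plane \<open>\<langle>y, q, q2\<rangle>\<close> the point \<open>r\<close> then arises on the line joining \<open>q\<close> to the point \<open>t\<close> of
  \<open>q2 k\<close> perpendicular to \<open>n\<close>.\<close>

lemma radical:
  assumes X: "dual_plane X" and yX: "y \<in> X"
  shows "\<exists>r\<in>P. (\<forall>w\<in>X. \<not> r \<sim> w) \<and>
    (\<forall>u. \<not> u \<sim> y \<and> \<not> u \<sim> r \<longleftrightarrow> (\<forall>w\<in>X. \<not> y \<sim> w \<longrightarrow> \<not> u \<sim> w))"
proof -
  obtain x where xX: "x \<in> X" and xy: "x \<noteq> y" "\<not> x \<sim> y" by (rule second_class_point[OF X yX])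
  obtain n where n: "n \<in> L" "n \<subseteq> X" "x \<in> n" by (rule line_in_plane_through[OF X xX])
  obtain m where m: "m \<in> L" "m \<subseteq> X" "x \<in> m" "m \<noteq> n" by (rule second_line_through[OF X n])
  have class_y: "y \<sim> w" if "w \<in> X" "x \<sim> w" for w
    using class_col[OF X xX yX that(1) xy(2) that(2)] .
  have yn: "y \<notin> n" using colI[OF n(1,3), of y] xy by blast
  have ym: "y \<notin> m" using colI[OF m(1,3), of y] xy by blast
  have "y \<notin> perp_set P L (perp_set P L n)" using line_perp_perp[OF n(1)] yn by blast
  then obtain q where q: "q \<in> P" "\<And>w. w \<in> n \<Longrightarrow> \<not> q \<sim> w" and yq: "y \<sim> q"
    using dual_plane_P[OF X yX] unfolding perp_set_def pls_perp_iff by blast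
  \<comment> \<open>A point \<open>w\<close> off \<open>n\<close> perpendicular to \<open>q\<close>
    would form, with two points of \<open>n\<close>, a triangle making \<open>q\<close>
    perpendicular to all of \<open>X\<close>, including \<open>y\<close>.\<close>
  have qX: "q \<sim> w" if w: "w \<in> X" "w \<notin> n" for w
  proof (rule ccontr)
    assume nw: "\<not> q \<sim> w"
    obtain a where a: "a \<in> n" "\<not> a \<sim> w" using dual_plane_class_meets_line[OF X w(1) n(1,2)] .
    obtain b where b: "b \<in> n" "b \<noteq> a" using line_two_points[OF n(1)] by blast
    have "a \<sim> b" using colI[OF n(1) a(1) b(1)] b by blast
    moreover have "a \<noteq> w" using a w by blast
    ultimately have "\<not> q \<sim> y"
      using perp_dual_plane[OF X _ _ w(1) _ a(2) _ q(2)[OF a(1)] q(2)[OF b(1)] nw yX] a b n by blast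
    then show False using yq col_sym by blast
  qed
  obtain p where p: "p \<in> n" "p \<noteq> x" using line_two_points[OF n(1)] by blast
  have pX: "p \<in> X" using p n by blast
  have xp: "x \<sim> p" using colI[OF n(1,3) p(1)] p by blast
  have yp: "y \<sim> p" using class_y[OF pX xp] .
  have qx: "\<not> q \<sim> x" and qp: "\<not> q \<sim> p" using q n p by blast+
  have q_notin: "q \<notin> X"
    using class_col[OF X xX _ pX _ xp, of q] qx qp col_sym by blast
  have mn: "w \<notin> n" if "w \<in> m" "w \<noteq> x" for w
    using line_unique[OF m(1) n(1) that(2) that(1)] that m n by blast
  have qm: "q \<sim> w" if "w \<in> m" "w \<noteq> x" for w using qX mn that m by blast
  have xm: "x \<sim> w" if "w \<in> m" "w \<noteq> x" for w using colI[OF m(1,3) that(1)] that by blast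
  obtain d where d: "d \<in> m" "d \<noteq> x" using line_two_points[OF m(1)] by blast
  have dX: "d \<in> X" using d m by blast
  obtain Y1 where Y1: "dual_plane Y1" "d \<in> Y1" "q \<in> Y1" "x \<in> Y1"
    using dual_plane_ex[of d q x] qm[OF d] xm[OF d] qx q_notin xX col_sym by blast
  have mY1: "m \<subseteq> Y1" using dual_plane_line[OF Y1(1) m(1) d(1) m(3) d(2)] Y1 by blast
  have "q \<noteq> x" using q_notin xX by blast
  then obtain q2 where q2: "q2 \<in> Y1" "q2 \<noteq> q" "q2 \<noteq> x" "\<not> q2 \<sim> q" "\<not> q2 \<sim> x"
    using third_class_point[OF Y1(1,3,4) _ qx] by blast
  have key: "g \<sim> q2" if "\<not> g \<sim> x" "g \<sim> q" for g
    using perp_class[OF Y1(1,4) q2(1) Y1(3), of g] q2 that qx col_sym by blast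
  have yq2: "y \<sim> q2" using key[of y] yq xy col_sym by blast
  have pq2: "p \<sim> q2"
    using perp_class[OF Y1(1,3) q2(1) Y1(4), of p] q2 qx qp xp col_sym by blast
  have q2X: "q2 \<notin> X" using class_y[of q2] dual_plane_perp_trans[OF X, of q2 x y] xX yX q2 xy yq2 col_sym
    by blast
  have q2d: "q2 \<sim> d" using class_col[OF Y1(1,4) q2(1) Y1(2)] xm[OF d] q2 col_sym by blast
  from q2d obtain h1 where h1: "h1 \<in> L" "q2 \<in> h1" "d \<in> h1" "q2 \<noteq> d" by (rule colE)
  have h1Y1: "h1 \<subseteq> Y1" using dual_plane_line[OF Y1(1) h1 q2(1) Y1(2)] .
  have qh1: "q \<notin> h1" using colI[OF h1(1,2), of q] q2 by blast
  have h1m: "h1 \<noteq> m" using colI[OF m(1) _ m(3), of q2] q2 h1 by blast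
  \<comment> \<open>The points \<open>j\<close> lie on the line \<open>q2 d\<close> and on lines
    joining \<open>q\<close> to \<open>m\<close>; they serve to carry relations from
    \<open>q\<close> over to \<open>q2\<close>.\<close>
  have j_ex: "\<exists>j h2. h2 \<in> L \<and> q \<in> h2 \<and> d2 \<in> h2 \<and> j \<in> h2 \<and> j \<in> h1 \<and> j \<noteq> q \<and> j \<noteq> d \<and> j \<noteq> d2 \<and>
      j \<notin> X" if d2: "d2 \<in> m" "d2 \<noteq> x" "d2 \<noteq> d" for d2
  proof -
    have "q \<sim> d2" using qm d2 by blast
    then obtain h2 where h2: "h2 \<in> L" "q \<in> h2" "d2 \<in> h2" "q \<noteq> d2" by (rule colE)
    have "h2 \<subseteq> Y1" using dual_plane_line[OF Y1(1) h2 Y1(3)] mY1 d2 by blast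
    then obtain j where j: "j \<in> h1" "j \<in> h2" using dual_plane_meet[OF Y1(1) h1(1) h1Y1 h2(1)] by blast
    have "d2 \<notin> h1" using line_unique[OF h1(1) m(1) d2(3)] h1 d d2 h1m by blast
    then have jd2: "j \<noteq> d2" using j by blast
    have "h2 \<noteq> m" using h2 q_notin m by blast
    then have "d \<notin> h2" using line_unique[OF h2(1) m(1) d2(3)] h2 d d2 by blast
    moreover have "j \<notin> X" using dual_plane_line[OF X h2(1) j(2) h2(3) jd2] d2 m h2 q_notin by blast
    ultimately show ?thesis using h2 j jd2 qh1 by blast
  qed
  \<comment> \<open>The line joining suitable points \<open>a\<close> of \<open>n\<close> and
    \<open>f\<close> of \<open>m\<close> is perpendicular to \<open>j\<close>. Its point
    perpendicular to \<open>d\<close> is then perpendicular to \<open>h1\<close>, hence to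
    \<open>q2\<close>.\<close>
  obtain a2 where a2: "a2 \<in> X" "a2 \<sim> x" "\<not> q2 \<sim> a2"
  proof -
    obtain d2 where d2: "d2 \<in> m" "d2 \<notin> {x, d}" using two_more_points[OF m(1)] by metis
    then obtain j h2 where j: "h2 \<in> L" "q \<in> h2" "d2 \<in> h2" "j \<in> h2" "j \<in> h1" "j \<noteq> q" "j \<noteq> d"
      "j \<noteq> d2" "j \<notin> X" using j_ex[of d2] by blast
    have d2X: "d2 \<in> X" using d2 m by blast
    obtain a where a: "a \<in> n" "\<not> a \<sim> d2" using dual_plane_class_meets_line[OF X d2X n(1,2)] .
    have aX: "a \<in> X" using a n by blast
    have qd2: "q \<noteq> d2" using q_notin d2X by blast
    have "\<not> a \<sim> j" using perp_line[OF j(1,2,3,4) qd2, of a] a q(2) col_sym by blast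
    have jY1: "j \<in> Y1" using j h1Y1 by blast
    obtain f where f: "f \<in> m" "\<not> f \<sim> j" using dual_plane_class_meets_line[OF Y1(1) jY1 m(1) mY1] .
    have fX: "f \<in> X" using f m by blast
    have "j \<sim> d2" using colI[OF j(1,4,3,8)] .
    then have "f \<noteq> d2" using f col_sym by blast
    then have "d2 \<sim> f" using colI[OF m(1) d2(1) f(1)] by blast
    then have "a \<sim> f" using class_col[OF X d2X aX fX] a col_sym by blast
    then obtain g where g: "g \<in> L" "a \<in> g" "f \<in> g" "a \<noteq> f" by (rule colE)
    have gX: "g \<subseteq> X" using dual_plane_line[OF X g aX fX] .
    obtain a2 where a2: "a2 \<in> g" "\<not> a2 \<sim> d" using dual_plane_class_meets_line[OF X dX g(1) gX] .
    have "\<not> j \<sim> a2" using perp_line[OF g(1,2,3) a2(1) g(4)] \<open>\<not> a \<sim> j\<close> f col_sym by blast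
    then have "\<not> a2 \<sim> q2" using perp_line[OF h1(1) j(5) h1(3,2) j(7)] a2 col_sym by blast
    moreover have "a2 \<sim> x" using class_col[OF X dX _ xX, of a2] xm[OF d] a2 gX col_sym by blast
    ultimately show ?thesis using that a2 gX col_sym by blast
  qed
  from a2(2) obtain c2 where c2: "c2 \<in> L" "a2 \<in> c2" "x \<in> c2" "a2 \<noteq> x" by (rule colE)
  have c2X: "c2 \<subseteq> X" using dual_plane_line[OF X c2 a2(1) xX] .
  \<comment> \<open>The line \<open>c2\<close> is perpendicular to \<open>q2\<close>, as
    \<open>n\<close> is to \<open>q\<close>. The line \<open>e1 e2\<close> meets it in a point
    perpendicular to \<open>q2\<close>, so its plane with \<open>q2\<close> is dual.\<close>
  have q2_plane: "\<exists>Y. dual_plane Y \<and> q2 \<in> Y \<and> e1 \<in> Y \<and> e2 \<in> Y"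
    if e: "e1 \<in> X" "e2 \<in> X" "e1 \<sim> e2" "q2 \<sim> e1" for e1 e2
  proof -
    from e(3) obtain h where h: "h \<in> L" "e1 \<in> h" "e2 \<in> h" "e1 \<noteq> e2" by (rule colE)
    have hX: "h \<subseteq> X" using dual_plane_line[OF X h e(1,2)] .
    obtain g where g: "g \<in> h" "g \<in> c2" using dual_plane_meet[OF X h(1) hX c2(1) c2X] .
    have q2g: "\<not> q2 \<sim> g" using perp_line[OF c2(1-3) g(2) c2(4) a2(3) q2(5)] .
    then have ge: "e1 \<noteq> g" using e by blast
    have "q2 \<noteq> g" using g hX q2X by blast
    then obtain Y where Y: "dual_plane Y" "e1 \<in> Y" "q2 \<in> Y" "g \<in> Y"
      using dual_plane_ex[of e1 q2 g] colI[OF h(1,2) g(1) ge] e(4) q2g col_sym by blast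
    then have "e2 \<in> Y" using dual_plane_line[OF Y(1) h(1,2) g(1) ge] h by blast
    then show ?thesis using Y by blast
  qed
  from yq obtain hy where hy: "hy \<in> L" "y \<in> hy" "q \<in> hy" "y \<noteq> q" by (rule colE)
  have q_q2_line: "q \<notin> g" if "g \<in> L" "q2 \<in> g" for g
    using colI[OF that, of q] q2 by blast
  have k_cases: "\<exists>g\<in>L. q2 \<in> g \<and> k \<in> g \<and> q2 \<noteq> k \<and> \<not> k \<sim> x \<and>
     ((\<exists>y2\<in>g. y2 \<in> X \<and> y2 \<noteq> y \<and> \<not> y2 \<sim> x) \<or>
      (\<exists>\<rho>\<in>g. \<exists>e\<in>X. (\<forall>w\<in>X. \<not> \<rho> \<sim> w) \<and> (\<forall>u. \<not> u \<sim> e \<longrightarrow> \<not> u \<sim> d \<longrightarrow> \<not> u \<sim> \<rho>)))"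
    if k: "k \<in> hy" "k \<noteq> q" "k \<noteq> y" for k
  proof -
    have kx: "\<not> k \<sim> x" using perp_line[OF hy(1-3) k(1) hy(4), of x] xy qx col_sym by blast
    have q2k: "q2 \<sim> k" using col_off_perp[OF hy(1,3,2) k(1), of q2] q2 yq2 k col_sym by blast
    have kX: "k \<notin> X" using dual_plane_line[OF X hy(1) k(1) hy(2) k(3)] yX hy q_notin by blast
    \<comment> \<open>Two candidates are needed: at most one point of \<open>h1\<close> is
      perpendicular to \<open>k\<close>, so \<open>k\<close> is collinear with \<open>ja\<close> or
      \<open>jb\<close>.\<close>
    obtain da db where dab: "da \<in> m" "db \<in> m" "da \<noteq> db" "da \<notin> {x, d}" "db \<notin> {x, d}"
      by (rule two_more_points[OF m(1)])
    obtain ja ha where ja: "ha \<in> L" "q \<in> ha" "da \<in> ha" "ja \<in> ha" "ja \<in> h1" "ja \<noteq> q" "ja \<noteq> d"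
      "ja \<noteq> da" "ja \<notin> X" using j_ex[of da] dab by blast
    obtain jb hb where jb: "hb \<in> L" "q \<in> hb" "db \<in> hb" "jb \<in> hb" "jb \<in> h1" "jb \<noteq> q" "jb \<noteq> d"
      "jb \<noteq> db" "jb \<notin> X" using j_ex[of db] dab by blast
    have "ja \<noteq> jb"
    proof
      assume "ja = jb"
      then have "ha = hb" using line_unique[OF ja(1) jb(1,6)] ja jb by blast
      then have "ha = m" using line_unique[OF ja(1) m(1) dab(3)] ja jb dab by blast
      then show False using ja m q_notin by blast
    qed
    then have "k \<sim> ja \<or> k \<sim> jb"
      using perp_line[OF h1(1) ja(5) jb(5) h1(2), of k] q2k col_sym by blast
    then obtain d2 j h2 where d2: "d2 \<in> m" "d2 \<noteq> x" "d2 \<noteq> d" and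
      j: "h2 \<in> L" "q \<in> h2" "d2 \<in> h2" "j \<in> h2" "j \<in> h1" "j \<noteq> q" "j \<noteq> d" "j \<noteq> d2" "j \<notin> X"
      and kj: "k \<sim> j"
      using ja jb dab by blast
    have d2X: "d2 \<in> X" using d2 m by blast
    have "y \<sim> d2" using class_y[OF d2X] xm d2 by blast
    then obtain c3 where c3: "c3 \<in> L" "y \<in> c3" "d2 \<in> c3" "y \<noteq> d2" by (rule colE)
    have c3X: "c3 \<subseteq> X" using dual_plane_line[OF X c3 yX d2X] .
    \<comment> \<open>As \<open>z\<close> is on \<open>n\<close>, it is perpendicular to
      \<open>q\<close>, so \<open>y\<close>, \<open>q\<close>, \<open>z\<close> span a dual plane.
      There the line \<open>kj\<close> meets the line \<open>y d2\<close> in a point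
      \<open>e\<close> of \<open>X\<close>.\<close>
    obtain z where z: "z \<in> c3" "z \<in> n" using dual_plane_meet[OF X c3(1) c3X n(1,2)] .
    have yz: "y \<noteq> z" using yn z by blast
    have "q \<noteq> z" using z n q_notin by blast
    then obtain Y2 where Y2: "dual_plane Y2" "y \<in> Y2" "q \<in> Y2" "z \<in> Y2"
      using dual_plane_ex[OF yq colI[OF c3(1,2) z(1) yz] q(2)[OF z(2)]] by blast
    have c3Y2: "c3 \<subseteq> Y2" using dual_plane_line[OF Y2(1) c3(1,2) z(1) yz Y2(2,4)] .
    have kY2: "k \<in> Y2" using dual_plane_line[OF Y2(1) hy Y2(2,3)] k by blast
    have "q \<noteq> d2" using q_notin d2X by blast
    then have jY2: "j \<in> Y2" using dual_plane_line[OF Y2(1) j(1,2,3) _ Y2(3)] c3Y2 c3 j by blast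
    from kj obtain c4 where c4: "c4 \<in> L" "k \<in> c4" "j \<in> c4" "k \<noteq> j" by (rule colE)
    have c4Y2: "c4 \<subseteq> Y2" using dual_plane_line[OF Y2(1) c4 kY2 jY2] .
    obtain e where e: "e \<in> c3" "e \<in> c4" using dual_plane_meet[OF Y2(1) c3(1) c3Y2 c4(1) c4Y2] .
    have eX: "e \<in> X" using e c3X by blast
    have je: "j \<noteq> e" using eX j by blast
    have "c3 \<noteq> m" using c3 ym by blast
    then have ed: "e \<noteq> d" using line_unique[OF c3(1) m(1) d2(3) c3(3)] e d d2 by blast
    from q2k obtain g where g: "g \<in> L" "q2 \<in> g" "k \<in> g" "q2 \<noteq> k" by (rule colE)
    have g_x: "\<not> w \<sim> x" if "w \<in> g" for w
      using perp_line[OF g(1,2,3) that g(4), of x] q2 kx col_sym by blast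
    \<comment> \<open>If \<open>d\<close> and \<open>e\<close> are collinear, \<open>g\<close> meets
      the line \<open>de\<close> inside \<open>X\<close>, giving \<open>y2\<close>. Otherwise
      \<open>g\<close> meets the class of \<open>d\<close> and \<open>e\<close>, giving
      \<open>\<rho>\<close>.\<close>
    have in_plane: "g \<subseteq> Y" if Y: "dual_plane Y" "j \<in> Y" "e \<in> Y" "d \<in> Y" for Y
    proof -
      have "k \<in> Y" using dual_plane_line[OF Y(1) c4(1,3) e(2) je Y(2,3)] c4 by blast
      moreover have "q2 \<in> Y" using dual_plane_line[OF Y(1) h1(1) j(5) h1(3) j(7) Y(2,4)] h1 by blast
      ultimately show ?thesis using dual_plane_line[OF Y(1) g] by blast
    qed
    show ?thesis
    proof (cases "d \<sim> e")
      case True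
      then obtain c5 where c5: "c5 \<in> L" "d \<in> c5" "e \<in> c5" "d \<noteq> e" by (rule colE)
      obtain Y3 where Y3: "dual_plane Y3" "q2 \<in> Y3" "d \<in> Y3" "e \<in> Y3"
        using q2_plane[OF dX eX True q2d] by blast
      have "j \<in> Y3" using dual_plane_line[OF Y3(1) h1 Y3(2,3)] j by blast
      then have gY3: "g \<subseteq> Y3" using in_plane Y3 by blast
      have c5': "c5 \<subseteq> Y3" "c5 \<subseteq> X"
        using dual_plane_line[OF Y3(1) c5 Y3(3,4)] dual_plane_line[OF X c5 dX eX] .
      obtain y2 where y2: "y2 \<in> g" "y2 \<in> c5" using dual_plane_meet[OF Y3(1) g(1) gY3 c5(1) c5'(1)] .
      have "y \<notin> g"
      proof
        assume "y \<in> g"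
        then have "g = hy" using line_unique[OF g(1) hy(1) k(3) g(3)] k hy by blast
        then show False using q_q2_line[OF g(1,2)] hy by blast
      qed
      then have "y2 \<in> X" "y2 \<noteq> y" "\<not> y2 \<sim> x" using y2 c5' g_x by blast+
      then show ?thesis using g kx y2(1) by (intro bexI[of _ g] conjI disjI1 bexI[of _ y2])
    next
      case False
      have "j \<sim> e" "j \<sim> d" using colI[OF c4(1,3) e(2) je] colI[OF h1(1) j(5) h1(3) j(7)] .
      then obtain Y3 where Y3: "dual_plane Y3" "j \<in> Y3" "e \<in> Y3" "d \<in> Y3"
        using dual_plane_ex[of j e d] False ed col_sym by blast
      have gY3: "g \<subseteq> Y3" using in_plane[OF Y3] .
      obtain \<rho> where \<rho>: "\<rho> \<in> g" "\<not> \<rho> \<sim> d" using dual_plane_class_meets_line[OF Y3(1,4) g(1) gY3] .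
      have \<rho>Y3: "\<rho> \<in> Y3" using \<rho> gY3 by blast
      have "\<not> \<rho> \<sim> e" using dual_plane_perp_trans[OF Y3(1) \<rho>Y3 Y3(4,3) \<rho>(2) False] .
      then have \<rho>_X: "\<forall>w\<in>X. \<not> \<rho> \<sim> w"
        using perp_dual_plane[OF X dX xX eX _ False _ \<rho>(2) g_x[OF \<rho>(1)]] xm[OF d] ed col_sym
        by blast
      have \<rho>_hull: "\<forall>u. \<not> u \<sim> e \<longrightarrow> \<not> u \<sim> d \<longrightarrow> \<not> u \<sim> \<rho>"
        using perp_class[OF Y3(1,3,4) \<rho>Y3 _ _ ed] False \<open>\<not> \<rho> \<sim> e\<close> col_sym by blast
      show ?thesis
      proof (intro bexI[of _ g] conjI disjI2)
        show "\<exists>\<rho>\<in>g. \<exists>e\<in>X. (\<forall>w\<in>X. \<not> \<rho> \<sim> w) \<and> (\<forall>u. \<not> u \<sim> e \<longrightarrow> \<not> u \<sim> d \<longrightarrow> \<not> u \<sim> \<rho>)"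
          using \<rho>_X \<rho>_hull eX \<rho>(1) by meson
      qed (use g kx in blast)+
    qed
  qed
  obtain Y4 where Y4: "dual_plane Y4" "y \<in> Y4" "q \<in> Y4" "q2 \<in> Y4"
    using dual_plane_ex[of y q q2] yq yq2 q2 col_sym by metis
  have hyY4: "hy \<subseteq> Y4" using dual_plane_line[OF Y4(1) hy Y4(2,3)] .
  obtain k g y2 where k: "k \<in> hy" "k \<noteq> q" "k \<noteq> y" "\<not> k \<sim> x"
    and g: "g \<in> L" "q2 \<in> g" "k \<in> g" "q2 \<noteq> k"
    and y2: "y2 \<in> g" "y2 \<in> X" "y2 \<noteq> y" "\<not> y2 \<sim> x"
  proof -
    obtain ka kb where k: "ka \<in> hy" "kb \<in> hy" "ka \<noteq> kb" "ka \<notin> {q, y}" "kb \<notin> {q, y}"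
      by (rule two_more_points[OF hy(1)])
    obtain ga where ga: "ga \<in> L" "q2 \<in> ga" "ka \<in> ga" "q2 \<noteq> ka" "\<not> ka \<sim> x"
      and ga_cases: "(\<exists>y2\<in>ga. y2 \<in> X \<and> y2 \<noteq> y \<and> \<not> y2 \<sim> x) \<or> (\<exists>\<rho>\<in>ga. \<exists>e\<in>X.
         (\<forall>w\<in>X. \<not> \<rho> \<sim> w) \<and> (\<forall>u. \<not> u \<sim> e \<longrightarrow> \<not> u \<sim> d \<longrightarrow> \<not> u \<sim> \<rho>))"
      using k_cases[of ka] k by blast
    obtain gb where gb: "gb \<in> L" "q2 \<in> gb" "kb \<in> gb" "q2 \<noteq> kb" "\<not> kb \<sim> x"
      and gb_cases: "(\<exists>y2\<in>gb. y2 \<in> X \<and> y2 \<noteq> y \<and> \<not> y2 \<sim> x) \<or> (\<exists>\<rho>\<in>gb. \<exists>e\<in>X.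
         (\<forall>w\<in>X. \<not> \<rho> \<sim> w) \<and> (\<forall>u. \<not> u \<sim> e \<longrightarrow> \<not> u \<sim> d \<longrightarrow> \<not> u \<sim> \<rho>))"
      using k_cases[of kb] k by blast
    have gab: "ga \<noteq> gb"
    proof
      assume "ga = gb"
      then have "ga = hy" using line_unique[OF ga(1) hy(1) k(3)] ga gb k by blast
      then show False using q_q2_line[OF ga(1,2)] hy by blast
    qed
    \<comment> \<open>If both candidates were exceptional, \<open>\<rho>\<close> and
      \<open>\<sigma>\<close> would be two points in the class of \<open>y\<close> in
      \<open>Y4\<close>, both perpendicular to \<open>p\<close>; then \<open>p\<close> would be
      perpendicular to \<open>y\<close>.\<close>
    have False if \<rho>: "\<rho> \<in> ga" "e \<in> X" "\<And>w. w \<in> X \<Longrightarrow> \<not> \<rho> \<sim> w"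
        "\<And>u. \<not> u \<sim> e \<Longrightarrow> \<not> u \<sim> d \<Longrightarrow> \<not> u \<sim> \<rho>"
      and \<sigma>: "\<sigma> \<in> gb" "\<And>w. w \<in> X \<Longrightarrow> \<not> \<sigma> \<sim> w" for \<rho> \<sigma> e
    proof -
      have "\<rho> \<noteq> q2" using \<rho>(3)[OF pX] pq2 col_sym by blast
      then have "\<rho> \<noteq> \<sigma>" using line_unique[OF ga(1) gb(1), of \<rho> q2] gab ga gb \<rho> \<sigma> by blast
      moreover have "\<not> \<rho> \<sim> \<sigma>" using \<rho>(4)[of \<sigma>] \<sigma>(2)[OF \<rho>(2)] \<sigma>(2)[OF dX] col_sym by blast
      moreover have "\<rho> \<in> Y4" using dual_plane_line[OF Y4(1) ga(1-4) Y4(4)] hyY4 k \<rho> by blast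
      moreover have "\<sigma> \<in> Y4" using dual_plane_line[OF Y4(1) gb(1-4) Y4(4)] hyY4 k \<sigma> by blast
      ultimately have "\<not> p \<sim> y"
        using perp_class[OF Y4(1) _ _ Y4(2), of \<rho> \<sigma> p] \<rho>(3)[OF yX] \<rho>(3)[OF pX] \<sigma>(2)[OF pX] col_sym
        by blast
      then show False using yp col_sym by blast
    qed
    then have "(\<exists>y2\<in>ga. y2 \<in> X \<and> y2 \<noteq> y \<and> \<not> y2 \<sim> x) \<or> (\<exists>y2\<in>gb. y2 \<in> X \<and> y2 \<noteq> y \<and> \<not> y2 \<sim> x)"
      using ga_cases gb_cases by metis
    then show thesis
      using that[of ka ga] that[of kb gb] k ga gb by blast
  qed
  have gY4: "g \<subseteq> Y4" using dual_plane_line[OF Y4(1) g Y4(4)] hyY4 k by blast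
  have y2y: "\<not> y2 \<sim> y" using dual_plane_perp_trans[OF X y2(2) xX yX y2(4) xy(2)] .
  have "p \<sim> y2" using class_col[OF X xX y2(2) pX] y2 xp col_sym by blast
  then obtain Y5 where Y5: "dual_plane Y5" "q2 \<in> Y5" "p \<in> Y5" "y2 \<in> Y5"
    using q2_plane[OF pX y2(2)] pq2 col_sym by blast
  have "q2 \<noteq> y2" using y2 q2X by blast
  then have "g \<subseteq> Y5" using dual_plane_line[OF Y5(1) g(1,2) y2(1) _ Y5(2,4)] by blast
  \<comment> \<open>Both \<open>q\<close> and \<open>t\<close> are perpendicular to \<open>x\<close>
    and \<open>p\<close>, so the whole line \<open>qt\<close> is. Its point \<open>r\<close>
    perpendicular to \<open>y\<close> is then perpendicular to the triangle \<open>x\<close>,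
    \<open>p\<close>, \<open>y\<close>, which spans \<open>X\<close>.\<close>
  then obtain t where t: "t \<in> g" "\<not> t \<sim> p" using dual_plane_class_meets_line[OF Y5(1,3) g(1)] by blast
  have tq2: "t \<noteq> q2" using t pq2 col_sym by blast
  have tx: "\<not> x \<sim> t" using perp_line[OF g(1-3) t(1) g(4), of x] q2 k col_sym by blast
  have "q \<sim> k" using colI[OF hy(1,3) k(1)] k by blast
  then have "q \<sim> t" using col_off_perp[OF g(1-3) t(1), of q] q2 tq2 col_sym by blast
  then obtain c6 where c6: "c6 \<in> L" "q \<in> c6" "t \<in> c6" "q \<noteq> t" by (rule colE)
  have c6Y4: "c6 \<subseteq> Y4" using dual_plane_line[OF Y4(1) c6 Y4(3)] gY4 t by blast
  obtain r where r: "r \<in> c6" "\<not> r \<sim> y" using dual_plane_class_meets_line[OF Y4(1,2) c6(1) c6Y4] .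
  have rp: "\<not> r \<sim> p" using perp_line[OF c6(1-3) r(1) c6(4), of p] qp t col_sym by blast
  have rx: "\<not> r \<sim> x" using perp_line[OF c6(1-3) r(1) c6(4), of x] qx tx col_sym by blast
  have rY4: "r \<in> Y4" using r c6Y4 by blast
  have y2Y4: "y2 \<in> Y4" using y2 gY4 by blast
  have ry: "y \<noteq> r" using rp yp by blast
  have yr: "\<not> y \<sim> r" "\<not> y \<sim> y2" using r y2y col_sym by blast+
  have "\<forall>w\<in>X. \<not> r \<sim> w"
    using perp_dual_plane[OF X xX pX yX xp xy(2,1) rx rp r(2)] by blast
  \<comment> \<open>The point \<open>y2\<close> links the two classes: it lies in the class of
    \<open>y\<close> in \<open>X\<close> and in the class of \<open>y\<close> and \<open>r\<close>
    in \<open>Y4\<close>.\<close>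
  moreover have "\<not> u \<sim> w" if u: "\<not> u \<sim> y" "\<not> u \<sim> r" and w: "w \<in> X" "\<not> y \<sim> w" for u w
  proof -
    have "\<not> u \<sim> y2" using perp_class[OF Y4(1,2) rY4 y2Y4 yr ry u] .
    then show ?thesis using perp_class[OF X yX y2(2) w(1) yr(2) w(2) _ u(1)] y2 by blast
  qed
  moreover have "\<not> u \<sim> y \<and> \<not> u \<sim> r"
    if u: "\<forall>w\<in>X. \<not> y \<sim> w \<longrightarrow> \<not> u \<sim> w" for u
  proof -
    have "\<not> u \<sim> y" "\<not> u \<sim> y2" using u yX y2(2) yr(2) by auto
    then show ?thesis using perp_class[OF Y4(1,2) y2Y4 rY4 yr(2,1), of u] y2(3) by blast
  qed
  ultimately show ?thesis using dual_plane_P[OF Y4(1) rY4]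
    by (intro bexI[of _ r] conjI allI iffI) blast+
qed

section \<open>The exchange property of singular lines\<close>

text \<open>In terms of closures: if \<open>z\<close> lies on the singular line of \<open>x\<close>
  and \<open>y\<close> and differs from \<open>x\<close>, then \<open>y\<close> lies on that of
  \<open>x\<close> and \<open>z\<close>.\<close>

lemma exchange:
  assumes P: "x \<in> P" "z \<in> P" and ne: "x \<noteq> z" and xy: "\<not> x \<sim> y"
    and hull: "\<And>u. \<not> u \<sim> x \<Longrightarrow> \<not> u \<sim> y \<Longrightarrow> \<not> u \<sim> z"
    and u: "\<not> u \<sim> x" "\<not> u \<sim> z"
  shows "\<not> u \<sim> y"
proof
  assume uy: "u \<sim> y"
  have yz: "\<not> y \<sim> z" using hull[of y] xy col_sym by auto
  have xz: "\<not> x \<sim> z" using hull[of x] xy by auto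
  have "\<not> perp_set P L {x} \<subseteq> perp_set P L {z}" using perp_inj P ne by blast
  then obtain p where px: "\<not> p \<sim> x" and pz: "p \<sim> z"
    unfolding perp_set_def pls_perp_iff by blast
  have py: "p \<sim> y" using hull px pz by blast
  \<comment> \<open>Otherwise \<open>y\<close>, \<open>v\<close>, \<open>p\<close> span a dual plane
    perpendicular to \<open>x\<close>. A second point \<open>w\<close> in the class of
    \<open>y\<close> is perpendicular to \<open>x\<close> and \<open>y\<close>, hence to
    \<open>z\<close>. So \<open>z\<close> is perpendicular to \<open>y\<close>, \<open>v\<close>,
    \<open>w\<close>, hence to \<open>p\<close>.\<close>
  have claim: "p \<sim> v" if v: "\<not> v \<sim> x" "\<not> v \<sim> z" "v \<sim> y" for v
  proof (rule ccontr)
    assume pv: "\<not> p \<sim> v"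
    have "v \<noteq> p" using v pz by blast
    then obtain Y where Y: "dual_plane Y" "y \<in> Y" "v \<in> Y" "p \<in> Y"
      using dual_plane_ex[of y v p] v py pv col_sym by blast
    obtain w where w: "w \<in> Y" "w \<noteq> y" "\<not> w \<sim> y" by (rule second_class_point[OF Y(1,2)])
    have "\<not> x \<sim> w"
      using perp_dual_plane[OF Y(1,3,2,4) v(3) _ \<open>v \<noteq> p\<close> _ xy _ w(1)] pv v px col_sym by blast
    then have "\<not> w \<sim> z" using hull[of w] w col_sym by blast
    then have "\<not> z \<sim> p"
      using perp_dual_plane[OF Y(1,2,3) w(1) _ _ _ _ _ _ Y(4), of z] v w yz col_sym by metis
    then show False using pz col_sym by blast
  qed
  have pu: "p \<sim> u" using claim u uy by blast
  have zu: "z \<noteq> u" using uy yz col_sym by blast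
  obtain Y where Y: "dual_plane Y" "p \<in> Y" "z \<in> Y" "u \<in> Y"
    using dual_plane_ex[of p z u] pz pu zu u col_sym by blast
  have zu': "\<not> z \<sim> u" using u col_sym by blast
  \<comment> \<open>As \<open>x\<close> is perpendicular to \<open>z\<close> and \<open>u\<close>,
    it is perpendicular to their class, hence to \<open>r\<close>; but \<open>y\<close> is collinear
    with \<open>r\<close>, as it is with \<open>u\<close>. So \<open>claim\<close> applies to
    \<open>r\<close>, although \<open>r\<close> is perpendicular to \<open>p\<close>.\<close>
  obtain r where r: "\<forall>w\<in>Y. \<not> r \<sim> w"
    "\<And>u. \<not> u \<sim> z \<and> \<not> u \<sim> r \<longleftrightarrow> (\<forall>w\<in>Y. \<not> z \<sim> w \<longrightarrow> \<not> u \<sim> w)"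
    using radical[OF Y(1,3)] by metis
  have "\<not> x \<sim> w" if w: "w \<in> Y" "\<not> z \<sim> w" for w
    using perp_class[OF Y(1,3,4) w(1) zu' w(2) zu xz] u col_sym by blast
  then have "\<not> x \<sim> r" using r(2)[of x] by blast
  moreover have "y \<sim> r" using r(2)[of y] yz Y(4) zu' uy col_sym by blast
  ultimately have "p \<sim> r" using claim[of r] r(1) Y(3) col_sym by blast
  then show False using r(1) Y(2) col_sym by blast
qed

section \<open>The polar space and its hyperbolic lines\<close>

abbreviation perp :: "'a set \<Rightarrow> 'a set" where "perp S \<equiv> perp_set P L S"

lemma mem_perp_iff: "v \<in> perp S \<longleftrightarrow> v \<in> P \<and> (\<forall>x\<in>S. \<not> v \<sim> x)"
  unfolding perp_set_def pls_perp_iff by blast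

definition polar_lines :: "'a set set" where
  "polar_lines = {perp (perp {x, y}) | x y. x \<in> P \<and> y \<in> P \<and> x \<noteq> y \<and> \<not> x \<sim> y}"

lemma perp_perp_exchange:
  assumes xy: "x \<in> P" "y \<in> P" "\<not> x \<sim> y" and z: "z \<in> perp (perp {x, y})" "x \<noteq> z"
  shows "perp {x, z} = perp {x, y}"
proof -
  have hull: "\<not> u \<sim> z" if "\<not> u \<sim> x" "\<not> u \<sim> y" for u
  proof
    assume "u \<sim> z"
    then have "u \<in> perp {x, y}" using that col_P mem_perp_iff by auto
    then have "\<not> z \<sim> u" using z(1) mem_perp_iff[of z] by blast
    then show False using \<open>u \<sim> z\<close> col_sym by blast
  qed
  have "z \<in> P" using z(1) mem_perp_iff[of z] by blast
  then have "\<not> u \<sim> y" if "\<not> u \<sim> x" "\<not> u \<sim> z" for u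
    using exchange[OF xy(1) _ z(2) xy(3) hull that] by blast
  with hull show ?thesis by (auto simp: set_eq_iff mem_perp_iff)
qed

text \<open>The points \<open>x\<close> and \<open>y\<close> are exchanged for \<open>u\<close> and
  \<open>v\<close> one at a time. Since \<open>x\<close> and \<open>y\<close> are perpendicular,
  \<open>perp (perp {x, y})\<close> lies in \<open>perp {x, y}\<close>, so \<open>u\<close> and
  \<open>v\<close> are perpendicular too.\<close>

lemma perp_perp_eq:
  assumes xy: "x \<in> P" "y \<in> P" "x \<noteq> y" "\<not> x \<sim> y"
    and uv: "u \<in> perp (perp {x, y})" "v \<in> perp (perp {x, y})" "u \<noteq> v"
  shows "perp {u, v} = perp {x, y}" "\<not> u \<sim> v"
proof -
  have P: "u \<in> P" "v \<in> P" using uv mem_perp_iff by blast+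
  have uv_xy: "w \<in> perp {x, y}" if "w \<in> perp (perp {x, y})" for w
  proof -
    have "x \<in> perp {x, y}" "y \<in> perp {x, y}" using xy col_sym unfolding mem_perp_iff by auto
    then show ?thesis using that unfolding mem_perp_iff[of w] by blast
  qed
  show "\<not> u \<sim> v" using uv(1) uv_xy[OF uv(2)] mem_perp_iff by blast
  show "perp {u, v} = perp {x, y}"
  proof (cases "x = u")
    case True
    then show ?thesis using perp_perp_exchange[OF xy(1,2,4) uv(2)] uv by blast
  next
    case False
    have eq: "perp {u, x} = perp {x, y}"
      using perp_perp_exchange[OF xy(1,2,4) uv(1) False] by (simp add: insert_commute)
    have "\<not> u \<sim> x" using uv_xy[OF uv(1)] mem_perp_iff[of u "{x, y}"] by blast
    then show ?thesis using perp_perp_exchange[OF P(1) xy(1), of v] uv eq by simp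
  qed
qed

lemma mem_perp_perp: "x \<in> P \<Longrightarrow> y \<in> P \<Longrightarrow> x \<in> perp (perp {x, y}) \<and> y \<in> perp (perp {x, y})"
  by (simp add: mem_perp_iff[of _ "perp _"] mem_perp_iff[of _ "{x, y}"] pls_collinear_sym[of _ x]
      pls_collinear_sym[of _ y])

lemma collinear_polar_lines:
  "pls_collinear polar_lines x y \<longleftrightarrow> x \<in> P \<and> y \<in> P \<and> x \<noteq> y \<and> \<not> x \<sim> y"
proof
  assume "pls_collinear polar_lines x y"
  then obtain a b where "x \<noteq> y" "a \<in> P" "b \<in> P" "a \<noteq> b" "\<not> a \<sim> b"
    "x \<in> perp (perp {a, b})" "y \<in> perp (perp {a, b})"
    unfolding pls_collinear_def polar_lines_def by blast
  then show "x \<in> P \<and> y \<in> P \<and> x \<noteq> y \<and> \<not> x \<sim> y"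
    using perp_perp_eq(2)[of a b x y] mem_perp_iff by blast
next
  assume *: "x \<in> P \<and> y \<in> P \<and> x \<noteq> y \<and> \<not> x \<sim> y"
  then have "perp (perp {x, y}) \<in> polar_lines" unfolding polar_lines_def by blast
  then show "pls_collinear polar_lines x y"
    unfolding pls_collinear_def using * mem_perp_perp by blast
qed

lemma polar_space_polar_lines: "polar_space P polar_lines"
proof
  fix l assume "l \<in> polar_lines"
  then obtain x y where xy: "x \<in> P" "y \<in> P" "x \<noteq> y" and l: "l = perp (perp {x, y})"
    unfolding polar_lines_def by blast
  show "l \<subseteq> P" unfolding l perp_set_def by blast
  show "\<exists>x\<in>l. \<exists>y\<in>l. x \<noteq> y" unfolding l using mem_perp_perp xy by blast
next
  fix l m x y
  assume l: "l \<in> polar_lines" and m: "m \<in> polar_lines"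
    and xy: "x \<noteq> y" "x \<in> l" "y \<in> l" "x \<in> m" "y \<in> m"
  have "k = perp (perp {x, y})" if k: "k \<in> polar_lines" "x \<in> k" "y \<in> k" for k
  proof -
    from k(1) obtain a b where ab: "a \<in> P" "b \<in> P" "a \<noteq> b" "\<not> a \<sim> b"
      and k': "k = perp (perp {a, b})"
      unfolding polar_lines_def by blast
    show ?thesis using perp_perp_eq(1)[OF ab, of x y] k xy(1) unfolding k' by simp
  qed
  then show "l = m" using l m xy by blast
next
  fix p l assume p: "p \<in> P" and l: "l \<in> polar_lines" "p \<notin> l"
  then obtain x y where xy: "x \<in> P" "y \<in> P" "x \<noteq> y" "\<not> x \<sim> y"
    and l': "l = perp (perp {x, y})"
    unfolding polar_lines_def by blast
  have lP: "q \<in> P" if "q \<in> l" for q using that unfolding l' mem_perp_iff by blast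
  have coll: "pls_collinear polar_lines p q \<longleftrightarrow> \<not> p \<sim> q" if "q \<in> l" for q
    unfolding collinear_polar_lines using p l that lP by blast
  \<comment> \<open>If \<open>p\<close> is collinear with \<open>x\<close> and \<open>y\<close>,
    these span a dual plane, and the point \<open>r\<close> of \<open>radical\<close> for the class
    of \<open>x\<close> lies on \<open>l\<close> and is perpendicular to \<open>p\<close>.\<close>
  have ex: "\<exists>q\<in>l. \<not> p \<sim> q"
  proof (cases "p \<sim> x \<and> p \<sim> y")
    case False
    then show ?thesis unfolding l' using mem_perp_perp xy by blast
  next
    case True
    then obtain X where X: "dual_plane X" "p \<in> X" "x \<in> X" "y \<in> X"
      using dual_plane_ex[of p x y] xy by blast
    obtain r where r: "r \<in> P" "\<forall>w\<in>X. \<not> r \<sim> w"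
      "\<And>u. \<not> u \<sim> x \<and> \<not> u \<sim> r \<longleftrightarrow> (\<forall>w\<in>X. \<not> x \<sim> w \<longrightarrow> \<not> u \<sim> w)"
      using radical[OF X(1,3)] by metis
    have "\<not> u \<sim> r" if u: "\<not> u \<sim> x" "\<not> u \<sim> y" for u
    proof -
      have "\<not> u \<sim> w" if w: "w \<in> X" "\<not> x \<sim> w" for w
        using perp_class[OF X(1,3,4) w(1) xy(4) w(2) xy(3) u] .
      then show ?thesis using r(3)[of u] by blast
    qed
    then have "\<not> r \<sim> u" if "u \<in> perp {x, y}" for u
      using that col_sym mem_perp_iff[of u "{x, y}"] by blast
    then have "r \<in> l" unfolding l' using r(1) mem_perp_iff[of r "perp {x, y}"] by blast
    then show ?thesis using r(2) X(2) col_sym by blast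
  qed
  \<comment> \<open>Any two points of \<open>l\<close> have the same perp as \<open>l\<close>, so
    perpendicularity to two of them extends to all.\<close>
  have all: "\<not> p \<sim> w" if uv: "u \<in> l" "v \<in> l" "u \<noteq> v" "\<not> p \<sim> u" "\<not> p \<sim> v" and w: "w \<in> l" for u v w
  proof -
    have "p \<in> perp {u, v}" unfolding mem_perp_iff using p uv by blast
    then have "p \<in> perp {x, y}" using perp_perp_eq(1)[OF xy, of u v] uv unfolding l' by blast
    then show ?thesis
      using w mem_perp_iff[of w "perp {x, y}"] col_sym unfolding l' by blast
  qed
  show "(\<exists>!q. q \<in> l \<and> pls_collinear polar_lines p q) \<or> (\<forall>q\<in>l. pls_collinear polar_lines p q)"
    using ex all coll by metis
qed

lemma polar_perp_polar_lines:
  assumes "S \<subseteq> P" shows "polar_perp P polar_lines S = perp S"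
proof -
  have "q = x \<or> pls_collinear polar_lines q x \<longleftrightarrow> \<not> q \<sim> x" if "q \<in> P" "x \<in> S" for q x
    unfolding collinear_polar_lines using that assms by auto
  then show ?thesis unfolding polar_perp_def perp_set_def pls_perp_iff by blast
qed

text \<open>By \<open>perp_line\<close>, two points of \<open>l\<close> have the same perp as
  \<open>l\<close>, and \<open>l\<close> is closed.\<close>

lemma perp_perp_collinear:
  assumes l: "l \<in> L" "x \<in> l" "y \<in> l" "x \<noteq> y"
  shows "perp (perp {x, y}) = l"
proof -
  have "perp {x, y} = perp l"
    using perp_line[OF l(1,2,3) _ l(4)] l unfolding perp_set_def pls_perp_iff by blast
  then show ?thesis using line_perp_perp l by simp
qed

text \<open>Distinct points non-collinear in the polar space are collinear in the original one, and
  their double perp is the line joining them. The identity is therefore the required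
  isomorphism.\<close>

lemma hyperbolic_lines_polar_lines: "hyperbolic_lines P polar_lines = L"
proof -
  have pp: "polar_perp P polar_lines (polar_perp P polar_lines {x, y}) = perp (perp {x, y})"
    if "x \<in> P" "y \<in> P" for x y
  proof -
    have "perp {x, y} \<subseteq> P" unfolding perp_set_def by blast
    then show ?thesis using polar_perp_polar_lines that by simp
  qed
  show ?thesis
  proof (intro set_eqI iffI)
    fix l assume "l \<in> hyperbolic_lines P polar_lines"
    then obtain x y where xy: "x \<in> P" "y \<in> P" "x \<noteq> y" "\<not> pls_collinear polar_lines x y"
      and l: "l = perp (perp {x, y})"
      unfolding hyperbolic_lines_def using pp by auto
    then have "x \<sim> y" using collinear_polar_lines by blast
    then show "l \<in> L" unfolding l using perp_perp_collinear by (metis colE)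
  next
    fix l assume l: "l \<in> L"
    then obtain x y where xy: "x \<in> l" "y \<in> l" "x \<noteq> y" using line_two_points by blast
    have "x \<in> P" "y \<in> P" using l xy line_subset by blast+
    moreover have "\<not> pls_collinear polar_lines x y"
      using colI[OF l xy] collinear_polar_lines by blast
    moreover have "l = polar_perp P polar_lines (polar_perp P polar_lines {x, y})"
      using pp perp_perp_collinear[OF l xy] calculation by simp
    ultimately show "l \<in> hyperbolic_lines P polar_lines"
      unfolding hyperbolic_lines_def using xy(3) by blast
  qed
qed

end

theorem mainTheorem2:
  fixes P :: "'a set" and L :: "'a set set"
  assumes "partial_linear_space P L"
    and "planar P L"
    and "pls_connected P L"
    and "pls_coconnected P L"
    and "\<exists>x\<in>P. \<exists>y\<in>P. x \<noteq> y \<and> \<not> pls_collinear L x y"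
    and a: "\<And>X. pls_plane P L X \<Longrightarrow>
              isomorphic_to_dual_affine_plane X (lines_in L X) \<or> linear_on L X"
    and b: "\<And>X. pls_plane P L X \<Longrightarrow> linear_on L X \<Longrightarrow>
              \<not> four_lines_in_six_points (lines_in L X)"
    and c: "\<And>x y. x \<in> P \<Longrightarrow> y \<in> P \<Longrightarrow> perp_set P L {x} \<subseteq> perp_set P L {y} \<Longrightarrow> x = y"
    and d: "\<And>l. l \<in> L \<Longrightarrow>
              (infinite l \<or> card l \<ge> 4) \<and> perp_set P L (perp_set P L l) = l"
  shows "\<exists>(Q :: 'a set) (K :: 'a set set).
           polar_space Q K \<and> polar_nondegenerate Q K \<and> polar_rank_ge Q K 2 \<and>
           pls_isomorphic P L Q (hyperbolic_lines Q K)"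
proof -
  interpret partial_linear_space P L by (rule assms(1))
  interpret hyperbolic_space P L
    by unfold_locales (use assms(2) a b c d in blast)+
  obtain x y where xy: "x \<in> P" "y \<in> P" "x \<noteq> y" "\<not> pls_collinear L x y" using assms(5) by blast
  have "polar_nondegenerate P polar_lines"
    unfolding polar_nondegenerate_def
  proof
    assume "\<exists>p\<in>P. \<forall>q\<in>P. p = q \<or> pls_collinear polar_lines p q"
    then obtain p where p: "p \<in> P" "\<And>q. q \<in> P \<Longrightarrow> \<not> pls_collinear L q p"
      using collinear_polar_lines col_sym by (metis pls_collinear_irrefl)
    \<comment> \<open>The perp of \<open>p\<close> is all of \<open>P\<close>, so condition
      \<open>c\<close> would identify every point with \<open>p\<close>.\<close>
    then have "perp_set P L {q} \<subseteq> perp_set P L {p}" for q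
      unfolding perp_set_def pls_perp_iff by blast
    then have "x = p" "y = p" using c p xy by blast+
    then show False using xy by simp
  qed
  moreover have "polar_lines \<noteq> {}" unfolding polar_lines_def using xy by blast
  moreover have "pls_isomorphic P L P (hyperbolic_lines P polar_lines)"
    unfolding pls_isomorphic_def hyperbolic_lines_polar_lines
    by (intro exI[of _ id]) simp
  moreover have "partial_linear_space P polar_lines"
    using polar_space_polar_lines by (rule polar_space.axioms)
  ultimately show ?thesis
    using polar_space_polar_lines partial_linear_space.polar_rank_ge_2_iff by blast
qed

end
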